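(* Let $T>0$, $\lambda>0$ and $0<\alpha\le 1$. Suppose bidders enter an auction on $[0,T]$ according to a homogeneous Poisson process of rate $\lambda$, and that, independently of the other bidders, a bidder who arrives at time $s_1$ behaves as follows. At time $s_1$ he places his bid with probability $\alpha$ and makes no further bids; otherwise he selects $s_2\sim U(s_1,T)$ as his next potential bid time. At time $s_2$ he again places his bid with probability $\alpha$ and makes no further bids; otherwise he selects $s_3\sim U(s_2,T)$ as his next potential bid time; and so on, until he places his single bid. Then the bid time $\tau$ of a randomly chosen bidder satisfies $$P(\tau\le t)=1-\Bigl(1-\frac{t}{T}\Bigr)^{\alpha},\qquad 0\le t\le T,$$ and the resulting process of bid arrivals is a nonhomogeneous Poisson process on $[0,T]$ with intensity function, for some constant $c>0$, $$\lambda(t)=c\Bigl(1-\frac{t}{T}\Bigr)^{\alpha-1},\qquad 0\le t< T .$$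
   Context: $U(a,b)$ denotes the uniform distribution on $(a,b)$. All decisions to bid (each with probability $\alpha$) are independent of each other and of the potential bid times; given $s_k$, the time $s_{k+1}$ is uniform on $(s_k,T)$ independently of the earlier history. A "randomly chosen bidder" is a bidder whose arrival time is uniformly distributed on $[0,T]$ (the law of a typical arrival of a homogeneous Poisson process on $[0,T]$) and who follows the described bidding rule. A nonhomogeneous Poisson process on $[0,T]$ with intensity function $\lambda(\cdot)$ is a counting process with independent increments such that the number of points in any interval $(u,v]$ is Poisson distributed with mean $\int_u^v\lambda(t)\,dt$. *)

theory Defs
  imports "HOL-Probability.Probability"
begin

text \<open>
  \<open>N t\<close> is the number of points in \<open>[0,t]\<close>, so that \<open>N v - N u\<close> is the number of points
  in \<open>(u,v]\<close>.  The intensity is only constrained on \<open>[0,T)\<close>, where it may be unbounded near \<open>T\<close>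
  but has to be integrable.  The Poisson probabilities are written out because the library's
  \<open>poisson_pmf\<close> excludes mean \<open>0\<close>, which occurs for \<open>u = v\<close>.
\<close>

definition poisson_process_on ::
    "'a measure \<Rightarrow> real \<Rightarrow> (real \<Rightarrow> real) \<Rightarrow> (real \<Rightarrow> 'a \<Rightarrow> nat) \<Rightarrow> bool" where
  "poisson_process_on M T r N \<longleftrightarrow>
     prob_space M \<and>
     (\<forall>t\<in>{0..T}. N t \<in> measurable M (count_space UNIV)) \<and>
     (AE \<omega> in M. N 0 \<omega> = 0) \<and>
     (\<forall>\<omega>\<in>space M. mono_on {0..T} (\<lambda>t. N t \<omega>) \<and>
        (\<forall>t\<in>{0..<T}. continuous (at_right t) (\<lambda>t. N t \<omega>))) \<and>
     (\<forall>t\<in>{0..<T}. 0 \<le> r t) \<and> set_integrable lborel {0..<T} r \<and>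
     (\<forall>(n::nat) (t::nat \<Rightarrow> real).
        0 \<le> t 0 \<and> (\<forall>i<n. t i \<le> t (Suc i)) \<and> t n \<le> T \<longrightarrow>
        prob_space.indep_vars M (\<lambda>_. count_space UNIV)
          (\<lambda>i \<omega>. N (t (Suc i)) \<omega> - N (t i) \<omega>) {..<n}) \<and>
     (\<forall>u v. 0 \<le> u \<and> u \<le> v \<and> v \<le> T \<longrightarrow>
        (\<forall>n. measure M {\<omega>\<in>space M. N v \<omega> - N u \<omega> = n} =
          (LINT x:{u<..<v}|lborel. r x) ^ n / fact n * exp (- (LINT x:{u<..<v}|lborel. r x))))"

text \<open>
  On the event \<open>E\<close>, the conditional law of \<open>Y\<close> given the sub-sigma-algebra \<open>F\<close> is \<open>U(a,b)\<close>,
  where the endpoint \<open>a\<close> is random.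
\<close>

definition cond_uniform ::
    "'a measure \<Rightarrow> 'a measure \<Rightarrow> ('a \<Rightarrow> bool) \<Rightarrow> ('a \<Rightarrow> real) \<Rightarrow> ('a \<Rightarrow> real) \<Rightarrow> real \<Rightarrow> bool" where
  "cond_uniform M F E Y a b \<longleftrightarrow>
     (\<forall>B\<in>sets borel. AE \<omega> in M. E \<omega> \<longrightarrow>
        real_cond_exp M F (\<lambda>\<omega>. indicator B (Y \<omega>)) \<omega> =
        measure (uniform_measure lborel {a \<omega><..<b}) B)"

text \<open>
  The bid is placed at the first potential bid time \<open>s k\<close> whose decision \<open>d k\<close> is positive;
  if there is none, no bid is ever placed (time \<open>\<infinity>\<close>).  Potential bid times are counted from
  \<open>0\<close>, so \<open>s 0\<close> is the arrival time; the sequences are continued beyond the bid, where they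
  no longer matter.
\<close>

definition bid_time :: "(nat \<Rightarrow> real) \<Rightarrow> (nat \<Rightarrow> bool) \<Rightarrow> ereal" where
  "bid_time s d = (if \<exists>k. d k then ereal (s (LEAST k. d k)) else \<infinity>)"

locale bidder = prob_space M for M :: "'a measure" +
  fixes T \<alpha> :: real and s :: "nat \<Rightarrow> 'a \<Rightarrow> real" and d :: "nat \<Rightarrow> 'a \<Rightarrow> bool"
  assumes time_measurable: "random_variable borel (s k)"
    and decision_prob: "prob {\<omega>\<in>space M. d k \<omega>} = \<alpha>"
    and decisions_indep: "indep_vars (\<lambda>_. count_space UNIV) d UNIV"
    and decisions_indep_times:
      "indep_set
         (sets (vimage_algebra (space M) (\<lambda>\<omega> k. d k \<omega>) (PiM UNIV (\<lambda>_. count_space UNIV))))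
         (sets (vimage_algebra (space M) (\<lambda>\<omega> k. s k \<omega>) (PiM UNIV (\<lambda>_. borel))))"
    and next_time:
      "cond_uniform M
         (vimage_algebra (space M) (\<lambda>\<omega>. \<lambda>l\<in>{..k}. s l \<omega>) (PiM {..k} (\<lambda>_. borel)))
         (\<lambda>_. True) (s (Suc k)) (s k) T"

text \<open>
  A random number \<open>K\<close> of bidders, labelled \<open>0, \<dots>, K - 1\<close>; the labels need not follow
  the order of arrival, and the variables with index \<open>i \<ge> K\<close> carry no meaning.  The information
  given which bidder \<open>i\<close>'s next potential bid time is uniform consists of the number of bidders,
  of \<open>i\<close>'s own earlier times, and of all times of the other bidders; this includes the whole
  arrival process, and expresses that the bidders behave independently of each other.
\<close>

locale bidder_population = prob_space M for M :: "'a measure" +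
  fixes T \<alpha> :: real and K :: "'a \<Rightarrow> nat"
    and S :: "nat \<Rightarrow> nat \<Rightarrow> 'a \<Rightarrow> real" and D :: "nat \<Rightarrow> nat \<Rightarrow> 'a \<Rightarrow> bool"
  assumes number_measurable: "random_variable (count_space UNIV) K"
    and time_measurable: "random_variable borel (S i k)"
    and arrival_range: "AE \<omega> in M. \<forall>i<K \<omega>. S i 0 \<omega> \<in> {0..T}"
    and decision_prob: "prob {\<omega>\<in>space M. D i k \<omega>} = \<alpha>"
    and decisions_indep: "indep_vars (\<lambda>_. count_space UNIV) (\<lambda>(i, k). D i k) UNIV"
    and decisions_indep_times:
      "indep_set
         (sets (vimage_algebra (space M) (\<lambda>\<omega> (i, k). D i k \<omega>) (PiM UNIV (\<lambda>_. count_space UNIV))))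
         (sets (vimage_algebra (space M) (\<lambda>\<omega>. (K \<omega>, \<lambda>(i, k). S i k \<omega>))
            (count_space UNIV \<Otimes>\<^sub>M PiM UNIV (\<lambda>_. borel))))"
    and next_time:
      "cond_uniform M
         (vimage_algebra (space M)
            (\<lambda>\<omega>. (K \<omega>, \<lambda>(j, l)\<in>{(j, l). j \<noteq> i \<or> l \<le> k}. S j l \<omega>))
            (count_space UNIV \<Otimes>\<^sub>M PiM {(j, l). j \<noteq> i \<or> l \<le> k} (\<lambda>_. borel)))
         (\<lambda>\<omega>. i < K \<omega>) (S i (Suc k)) (S i k) T"

definition arrival_count ::
    "('a \<Rightarrow> nat) \<Rightarrow> (nat \<Rightarrow> nat \<Rightarrow> 'a \<Rightarrow> real) \<Rightarrow> real \<Rightarrow> 'a \<Rightarrow> nat" where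
  "arrival_count K S t \<omega> = card {i. i < K \<omega> \<and> S i 0 \<omega> \<le> t}"

definition bid_count ::
    "('a \<Rightarrow> nat) \<Rightarrow> (nat \<Rightarrow> nat \<Rightarrow> 'a \<Rightarrow> real) \<Rightarrow> (nat \<Rightarrow> nat \<Rightarrow> 'a \<Rightarrow> bool) \<Rightarrow> real \<Rightarrow> 'a \<Rightarrow> nat" where
  "bid_count K S D t \<omega> =
     card {i. i < K \<omega> \<and> bid_time (\<lambda>k. S i k \<omega>) (\<lambda>k. D i k \<omega>) \<le> ereal t}"

end

(*
  Started at x < T, the chain of potential bid times has one-step kernel
  (Q f)(x) = mean of f over (x, T), and a bid with weight w contributes
  g(x) = sum over k of \<alpha> (1 - \<alpha>)^k (Q^k w)(x), the unique bounded solution of g = \<alpha> w + (1 - \<alpha>) Q g.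
  For w the indicator of {..t} this solution is 1 - (1 - \<alpha>) ((T - t) / (T - x))^\<alpha> for x \<le> t and 0 for x > t;
  averaging over a uniform arrival time gives the law of the bid time.

  For several bidders, E[prod_i w(bid_i)] = E[prod_i g(arrival_i)], by replacing one bidder after the
  other.  The right-hand side is symmetric in the bidders, so the labels do not matter, and approximating
  the left-continuous g by step functions reduces it to the increments of the arrival process:
  it equals exp(- rate * integral of (1 - g)).  With w equal to z_j on the j-th cell of a partition and 1
  elsewhere this is the joint probability generating function of independent Poisson variables,
  and comparing power series coefficients one variable at a time recovers their joint law.
*)
theory Submission
  imports Defs
begin

section \<open>Integrating against the uniform kernel\<close>

text \<open>The power \<alpha> in the solution has a probabilistic origin:
  \<open>(T - s (Suc k)) / (T - s k)\<close> is uniform on \<open>(0, 1)\<close>, so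
  \<open>- ln (T - s k)\<close> grows by independent exponential steps of rate 1. Keeping each step
  with probability \<alpha> thins this rate-1 Poisson process to rate \<alpha>; avoiding
  \<open>(x, t]\<close> then costs \<open>((T - t) / (T - x)) powr \<alpha>\<close>, and not bidding
  on arrival costs the factor \<open>1 - \<alpha>\<close>. The proof only verifies the formula so
  obtained. The obstacle with many bidders is that the law of a next potential time is known only
  conditionally, and the index of the potential time at which the bid is placed is random. The
  decisions, being independent of all times, are therefore frozen first. For a fixed number of
  bidders and fixed indices, each chain can be pulled back to its arrival, because the factors of
  all other bidders are measurable for the conditioning sigma-algebra. Only afterwards are the
  decisions averaged, at fixed arrival times, where they factor over the bidders. Working with
  nonnegative extended reals keeps integrability questions away from these exchanges.\<close>

definition unif_mean :: "real \<Rightarrow> (real \<Rightarrow> ennreal) \<Rightarrow> real \<Rightarrow> ennreal" where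
  "unif_mean T f x = (\<integral>\<^sup>+ y. f y \<partial>uniform_measure lborel {x<..<T})"

lemma unif_mean_eq:
  assumes [measurable]: "f \<in> borel_measurable borel"
  shows "unif_mean T f x = (\<integral>\<^sup>+ y. f y * indicator {x<..<T} y \<partial>lborel) / ennreal (T - x)"
proof -
  have "emeasure lborel {x<..<T} = ennreal (T - x)"
    by (cases "x \<le> T") (auto simp: ennreal_neg)
  then show ?thesis
    unfolding unif_mean_def by (subst nn_integral_uniform_measure) auto
qed

lemma measurable_unif_mean [measurable]:
  assumes [measurable]: "f \<in> borel_measurable borel"
  shows "unif_mean T f \<in> borel_measurable borel"
proof -
  have [measurable]: "Measurable.pred (borel \<Otimes>\<^sub>M lborel) (\<lambda>p. snd p \<in> {fst p<..<T})"
    by simp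
  have "(\<lambda>x. (\<integral>\<^sup>+ y. f y * indicator {x<..<T} y \<partial>lborel) / ennreal (T - x)) \<in> borel_measurable borel"
    by measurable
  then show ?thesis
    by (subst measurable_cong[OF unif_mean_eq]) auto
qed

lemma measurable_funpow_unif_mean [measurable]:
  "f \<in> borel_measurable borel \<Longrightarrow> (unif_mean T ^^ k) f \<in> borel_measurable borel"
  by (induction k) (auto intro: measurable_unif_mean)

lemma unif_mean_le_1:
  assumes [measurable]: "f \<in> borel_measurable borel" and "\<And>x. f x \<le> 1"
  shows "unif_mean T f x \<le> 1"
proof (cases "x < T")
  case True
  then interpret prob_space "uniform_measure lborel {x<..<T}"
    by (intro prob_space_uniform_measure) auto
  have "unif_mean T f x \<le> (\<integral>\<^sup>+ y. 1 \<partial>uniform_measure lborel {x<..<T})"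
    unfolding unif_mean_def by (intro nn_integral_mono assms)
  also have "\<dots> = 1"
    using emeasure_space_1 by (simp only: nn_integral_const mult_1)
  finally show ?thesis .
qed (simp add: unif_mean_eq)

lemma funpow_unif_mean_le_1:
  assumes "f \<in> borel_measurable borel" "\<And>x. f x \<le> 1"
  shows "(unif_mean T ^^ k) f x \<le> 1"
  using assms by (induction k arbitrary: x) (auto intro: unif_mean_le_1)

text \<open>\<open>cond_uniform\<close> speaks only of indicators of \<open>Y\<close>; induction
  over nonnegative Borel functions extends it to all \<open>f\<close>, tested against an
  \<open>F\<close>-measurable factor \<open>X\<close>. Since the conditional law is prescribed only
  on \<open>E\<close>, the factor has to vanish off \<open>E\<close>.\<close>

lemma (in prob_space) nn_integral_cond_uniform:
  assumes F: "subalgebra M F" and unif: "cond_uniform M F E Y a T"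
    and [measurable]: "Y \<in> borel_measurable M" "a \<in> borel_measurable F"
      "X \<in> borel_measurable F" "f \<in> borel_measurable borel"
    and X0: "\<And>\<omega>. \<not> E \<omega> \<Longrightarrow> X \<omega> = (0::ennreal)"
  shows "(\<integral>\<^sup>+ \<omega>. X \<omega> * f (Y \<omega>) \<partial>M) = (\<integral>\<^sup>+ \<omega>. X \<omega> * unif_mean T f (a \<omega>) \<partial>M)"
proof -
  interpret finite_measure_subalgebra M F
    by standard (rule F)
  have [measurable]: "a \<in> borel_measurable M" "X \<in> borel_measurable M"
    using assms(4,5) F by (auto intro: measurable_from_subalg)
  show ?thesis using assms(6)
  proof (induction rule: borel_measurable_induct)
    case (cong f g)
    then show ?case by simp
  next
    case (set B)
    then have [measurable]: "B \<in> sets borel" by simp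
    let ?i = "\<lambda>\<omega>. indicator B (Y \<omega>) :: real"
    \<comment> \<open>\<open>real_cond_exp\<close> is the difference of the
      \<open>nn_cond_exp\<close> of positive and negative part. The negative part of an indicator is
      0, and its positive part is at most 1 and so has finite conditional expectation; hence the two
      notions agree here.\<close>
    have n0: "AE \<omega> in M. nn_cond_exp M F (\<lambda>\<omega>. ennreal (- ?i \<omega>)) \<omega> = 0"
    proof -
      have "(\<lambda>\<omega>. ennreal (- ?i \<omega>)) = (\<lambda>_. 0)"
        by (auto simp: indicator_def fun_eq_iff ennreal_neg)
      then show ?thesis using nn_cond_exp_F_meas[of "\<lambda>_. 0"] by auto
    qed
    have le: "AE \<omega> in M. nn_cond_exp M F (\<lambda>\<omega>. ennreal (?i \<omega>)) \<omega> \<le> nn_cond_exp M F (\<lambda>_. 1) \<omega>"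
      by (rule nn_cond_exp_mono) (auto simp: indicator_def)
    have n1: "AE \<omega> in M. 1 = nn_cond_exp M F (\<lambda>_. 1) \<omega>"
      by (rule nn_cond_exp_F_meas) auto
    have U: "AE \<omega> in M. E \<omega> \<longrightarrow> real_cond_exp M F ?i \<omega> = measure (uniform_measure lborel {a \<omega><..<T}) B"
      using unif unfolding cond_uniform_def by auto
    have eq: "unif_mean T (indicator B) x = ennreal (measure (uniform_measure lborel {x<..<T}) B)" for x
    proof (cases "x < T")
      case True
      then interpret U: prob_space "uniform_measure lborel {x<..<T}"
        by (intro prob_space_uniform_measure) auto
      show ?thesis
        unfolding unif_mean_def by (simp add: U.emeasure_eq_measure del: measure_uniform_measure emeasure_uniform_measure)
    next
      case False
      then show ?thesis
        unfolding unif_mean_def by (simp add: measure_def)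
    qed
    have "(\<integral>\<^sup>+ \<omega>. X \<omega> * indicator B (Y \<omega>) \<partial>M) = (\<integral>\<^sup>+ \<omega>. X \<omega> * ennreal (?i \<omega>) \<partial>M)"
      by (intro nn_integral_cong) (auto simp: indicator_def)
    also have "\<dots> = (\<integral>\<^sup>+ \<omega>. X \<omega> * nn_cond_exp M F (\<lambda>\<omega>. ennreal (?i \<omega>)) \<omega> \<partial>M)"
      by (rule nn_cond_exp_intg[symmetric]) auto
    also have "\<dots> = (\<integral>\<^sup>+ \<omega>. X \<omega> * unif_mean T (indicator B) (a \<omega>) \<partial>M)"
    proof (rule nn_integral_cong_AE)
      show "AE \<omega> in M. X \<omega> * nn_cond_exp M F (\<lambda>\<omega>. ennreal (?i \<omega>)) \<omega> = X \<omega> * unif_mean T (indicator B) (a \<omega>)"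
        using n0 le n1 U
      proof eventually_elim
        case (elim \<omega>)
        show ?case
        proof (cases "E \<omega>")
          case True
          have "nn_cond_exp M F (\<lambda>\<omega>. ennreal (?i \<omega>)) \<omega> < \<infinity>"
            using elim(2,3) by (metis ennreal_one_less_top infinity_ennreal_def order_le_less_trans)
          then have "nn_cond_exp M F (\<lambda>\<omega>. ennreal (?i \<omega>)) \<omega> = ennreal (real_cond_exp M F ?i \<omega>)"
            unfolding real_cond_exp_def using elim(1) by simp
          then show ?thesis using elim(4) True eq by simp
        qed (simp add: X0)
      qed
    qed
    finally show ?case .
  next
    case (mult u c)
    have [measurable]: "u \<in> borel_measurable borel" using mult by simp
    have "unif_mean T (\<lambda>x. c * u x) = (\<lambda>x. c * unif_mean T u x)"
      unfolding unif_mean_def by (intro ext nn_integral_cmult) simp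
    then have "(\<integral>\<^sup>+ \<omega>. X \<omega> * unif_mean T (\<lambda>x. c * u x) (a \<omega>) \<partial>M) = c * (\<integral>\<^sup>+ \<omega>. X \<omega> * unif_mean T u (a \<omega>) \<partial>M)"
      by (simp add: nn_integral_cmult[symmetric] ac_simps)
    also have "\<dots> = (\<integral>\<^sup>+ \<omega>. X \<omega> * (c * u (Y \<omega>)) \<partial>M)"
      unfolding mult.IH[symmetric] by (simp add: nn_integral_cmult[symmetric] ac_simps)
    finally show ?case by simp
  next
    case (add u v)
    have [measurable]: "u \<in> borel_measurable borel" "v \<in> borel_measurable borel" using add by auto
    have "unif_mean T (\<lambda>x. u x + v x) = (\<lambda>x. unif_mean T u x + unif_mean T v x)"
      unfolding unif_mean_def by (intro ext nn_integral_add) auto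
    then have "(\<integral>\<^sup>+ \<omega>. X \<omega> * unif_mean T (\<lambda>x. u x + v x) (a \<omega>) \<partial>M)
       = (\<integral>\<^sup>+ \<omega>. X \<omega> * unif_mean T u (a \<omega>) \<partial>M) + (\<integral>\<^sup>+ \<omega>. X \<omega> * unif_mean T v (a \<omega>) \<partial>M)"
      by (simp add: nn_integral_add[symmetric] distrib_left)
    also have "\<dots> = (\<integral>\<^sup>+ \<omega>. X \<omega> * (u (Y \<omega>) + v (Y \<omega>)) \<partial>M)"
      unfolding add.IH[symmetric] by (simp add: nn_integral_add[symmetric] distrib_left)
    finally show ?case by (simp add: add.commute)
  next
    case (seq U)
    have [measurable]: "\<And>i. U i \<in> borel_measurable borel" using seq by auto
    have incU: "incseq (\<lambda>i. U i x)" for x using seq by (auto simp: incseq_def le_fun_def)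
    have inc: "incseq (\<lambda>i. unif_mean T (U i) x)" for x
      unfolding unif_mean_def incseq_def using incU by (auto intro!: nn_integral_mono simp: incseq_def)
    have "unif_mean T (\<lambda>x. SUP i. U i x) = (\<lambda>x. SUP i. unif_mean T (U i) x)"
      unfolding unif_mean_def
      by (intro ext nn_integral_monotone_convergence_SUP seq(3)) auto
    then have "(\<integral>\<^sup>+ \<omega>. X \<omega> * unif_mean T (\<lambda>x. SUP i. U i x) (a \<omega>) \<partial>M)
       = (\<integral>\<^sup>+ \<omega>. (SUP i. X \<omega> * unif_mean T (U i) (a \<omega>)) \<partial>M)"
      by (simp add: SUP_mult_left_ennreal)
    also have "\<dots> = (SUP i. \<integral>\<^sup>+ \<omega>. X \<omega> * unif_mean T (U i) (a \<omega>) \<partial>M)"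
      using inc by (intro nn_integral_monotone_convergence_SUP)
        (auto simp: incseq_def le_fun_def intro!: mult_left_mono)
    also have "\<dots> = (SUP i. \<integral>\<^sup>+ \<omega>. X \<omega> * U i (Y \<omega>) \<partial>M)"
      using seq by simp
    also have "\<dots> = (\<integral>\<^sup>+ \<omega>. (SUP i. X \<omega> * U i (Y \<omega>)) \<partial>M)"
      using incU by (intro nn_integral_monotone_convergence_SUP[symmetric])
        (auto simp: incseq_def le_fun_def intro!: mult_left_mono)
    finally show ?case by (simp add: SUP_mult_left_ennreal image_comp)
  qed
qed

text \<open>Each step back along the chain turns \<open>f\<close> at \<open>s (Suc k)\<close> into
  its kernel mean at \<open>s k\<close>, so the induction runs with \<open>f\<close> arbitrary. The
  factor \<open>X\<close> must be measurable for every \<open>F k\<close>, since it is carried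
  through all steps.\<close>

lemma (in prob_space) nn_integral_cond_uniform_chain:
  assumes "\<And>k. subalgebra M (F k)" "\<And>k. cond_uniform M (F k) E (s (Suc k)) (s k) T"
    and "\<And>k. s k \<in> borel_measurable (F k)" "\<And>k. X \<in> borel_measurable (F k)"
    and "f \<in> borel_measurable borel" "\<And>\<omega>. \<not> E \<omega> \<Longrightarrow> X \<omega> = (0::ennreal)"
  shows "(\<integral>\<^sup>+ \<omega>. X \<omega> * f (s k \<omega>) \<partial>M) = (\<integral>\<^sup>+ \<omega>. X \<omega> * (unif_mean T ^^ k) f (s 0 \<omega>) \<partial>M)"
  using assms(5)
proof (induction k arbitrary: f)
  case (Suc k)
  have "s (Suc k) \<in> borel_measurable M"
    using assms(1,3) measurable_from_subalg by blast
  then have "(\<integral>\<^sup>+ \<omega>. X \<omega> * f (s (Suc k) \<omega>) \<partial>M) = (\<integral>\<^sup>+ \<omega>. X \<omega> * unif_mean T f (s k \<omega>) \<partial>M)"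
    using assms Suc.prems by (intro nn_integral_cond_uniform) auto
  then show ?case
    using Suc by (simp add: funpow_swap1)
qed simp

section \<open>Decisions\<close>

lemma unif_mean_cong:
  assumes "f \<in> borel_measurable borel" "g \<in> borel_measurable borel" "\<And>y. y < T \<Longrightarrow> f y = g y"
  shows "unif_mean T f x = unif_mean T g x"
  using assms by (simp add: unif_mean_eq) (auto intro!: arg_cong2[where f=divide] nn_integral_cong simp: indicator_def)

lemma unif_mean_add:
  assumes [measurable]: "f \<in> borel_measurable borel" "g \<in> borel_measurable borel"
  shows "unif_mean T (\<lambda>x. f x + g x) x = unif_mean T f x + unif_mean T g x"
  unfolding unif_mean_def by (rule nn_integral_add) auto

lemma unif_mean_cmult:
  assumes [measurable]: "f \<in> borel_measurable borel"
  shows "unif_mean T (\<lambda>x. c * f x) x = c * unif_mean T f x"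
  unfolding unif_mean_def by (rule nn_integral_cmult) auto

lemma unif_mean_sum:
  assumes [measurable]: "\<And>i. i \<in> I \<Longrightarrow> f i \<in> borel_measurable borel"
  shows "unif_mean T (\<lambda>x. \<Sum>i\<in>I. f i x) x = (\<Sum>i\<in>I. unif_mean T (f i) x)"
  unfolding unif_mean_def by (rule nn_integral_sum) auto

text \<open>Iterating the equation \<open>n\<close> times yields the first \<open>n\<close> terms of
  the series plus the remainder \<open>(1 - \<alpha>) ^ n\<close> times an iterated mean of
  \<open>g\<close>, which tends to 0 because \<open>g\<close> is bounded by 1. The equation is
  needed only below \<open>T\<close>, since the kernel never charges points from \<open>T\<close>
  on.\<close>

lemma suminf_geometric_unif_mean:
  fixes \<alpha> :: real
  assumes \<alpha>: "0 < \<alpha>" "\<alpha> \<le> 1"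
    and [measurable]: "w \<in> borel_measurable borel" "g \<in> borel_measurable borel"
    and g1: "\<And>x. g x \<le> 1"
    and fixp: "\<And>x. x < T \<Longrightarrow> g x = ennreal \<alpha> * w x + ennreal (1 - \<alpha>) * unif_mean T g x"
    and x: "x < T"
  shows "(\<Sum>k. ennreal (\<alpha> * (1 - \<alpha>) ^ k) * (unif_mean T ^^ k) w x) = g x"
proof -
  have fin: "g x = (\<Sum>k<n. ennreal (\<alpha> * (1 - \<alpha>) ^ k) * (unif_mean T ^^ k) w x)
      + ennreal ((1 - \<alpha>) ^ n) * (unif_mean T ^^ n) g x" (is "_ = ?S n x + ?R n x")
    if "x < T" for n x
    using that
  proof (induction n arbitrary: x)
    case (Suc n)
    have "unif_mean T g x = unif_mean T (\<lambda>x. ?S n x + ?R n x) x"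
      using Suc.IH by (intro unif_mean_cong) auto
    also have "\<dots> = unif_mean T (?S n) x + unif_mean T (?R n) x"
      by (rule unif_mean_add) auto
    also have "unif_mean T (?S n) x = (\<Sum>k<n. ennreal (\<alpha> * (1 - \<alpha>) ^ k) * (unif_mean T ^^ Suc k) w x)"
      by (simp add: unif_mean_sum unif_mean_cmult)
    also have "unif_mean T (?R n) x = ennreal ((1 - \<alpha>) ^ n) * (unif_mean T ^^ Suc n) g x"
      by (simp add: unif_mean_cmult)
    finally have *: "unif_mean T g x = (\<Sum>k<n. ennreal (\<alpha> * (1 - \<alpha>) ^ k) * (unif_mean T ^^ Suc k) w x)
        + ennreal ((1 - \<alpha>) ^ n) * (unif_mean T ^^ Suc n) g x" .
    have e: "ennreal (1 - \<alpha>) * (ennreal (\<alpha> * (1 - \<alpha>) ^ k) * c) = ennreal (\<alpha> * (1 - \<alpha>) ^ Suc k) * c" for k c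
      using \<alpha> by (subst mult.assoc[symmetric]) (simp add: ennreal_mult[symmetric] mult.left_commute)
    have e': "ennreal (1 - \<alpha>) * (ennreal ((1 - \<alpha>) ^ k) * c) = ennreal ((1 - \<alpha>) ^ Suc k) * c" for k c
      using \<alpha> by (subst mult.assoc[symmetric]) (simp add: ennreal_mult[symmetric] mult.left_commute)
    show ?case
      unfolding fixp[OF Suc.prems] *
      by (subst sum.lessThan_Suc_shift)
        (simp only: distrib_left sum_distrib_left e e' power_0 funpow_0 mult_1_right add.assoc)
  qed simp
  have "(\<lambda>n. ?R n x) \<longlonglongrightarrow> 0"
  proof (rule tendsto_sandwich[of "\<lambda>_. 0" _ _ "\<lambda>n. ennreal ((1 - \<alpha>) ^ n)"])
    show "\<forall>\<^sub>F n in sequentially. ?R n x \<le> ennreal ((1 - \<alpha>) ^ n)"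
      using mult_left_mono[OF funpow_unif_mean_le_1[OF assms(4) g1], of "ennreal ((1 - \<alpha>) ^ n)" for n]
      by simp
    have "(\<lambda>n. (1 - \<alpha>) ^ n) \<longlonglongrightarrow> 0"
      using \<alpha> by (intro LIMSEQ_realpow_zero) auto
    then show "(\<lambda>n. ennreal ((1 - \<alpha>) ^ n)) \<longlonglongrightarrow> 0"
      using tendsto_ennrealI by fastforce
  qed auto
  moreover have "(\<lambda>n. ?S n x) \<longlonglongrightarrow> (\<Sum>k. ennreal (\<alpha> * (1 - \<alpha>) ^ k) * (unif_mean T ^^ k) w x)"
    by (rule summable_LIMSEQ) auto
  ultimately have "(\<lambda>n. ?S n x + ?R n x) \<longlonglongrightarrow> (\<Sum>k. ennreal (\<alpha> * (1 - \<alpha>) ^ k) * (unif_mean T ^^ k) w x) + 0"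
    by (intro tendsto_add)
  then have "(\<lambda>n. g x) \<longlonglongrightarrow> (\<Sum>k. ennreal (\<alpha> * (1 - \<alpha>) ^ k) * (unif_mean T ^^ k) w x)"
    unfolding fin[OF x, symmetric] by simp
  then show ?thesis
    by (simp add: LIMSEQ_const_iff)
qed

section \<open>The first positive decision, and integration over independent data\<close>

context prob_space begin

context
  fixes d :: "nat \<Rightarrow> 'a \<Rightarrow> bool" and \<alpha> :: real
  assumes ind: "indep_vars (\<lambda>_. count_space UNIV) d UNIV"
    and prob: "\<And>k. prob {\<omega>\<in>space M. d k \<omega>} = \<alpha>" and \<alpha>: "0 < \<alpha>" "\<alpha> \<le> 1"
begin

lemma measurable_trial: "d k \<in> measurable M (count_space UNIV)"
  using ind unfolding indep_vars_def2 by simp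

lemma prob_first_success:
  "prob {\<omega>\<in>space M. d k \<omega> \<and> (\<forall>l<k. \<not> d l \<omega>)} = \<alpha> * (1 - \<alpha>) ^ k"
proof -
  note [measurable] = measurable_trial
  let ?A = "\<lambda>l. {l = k}"
  have "(d k \<omega> \<and> (\<forall>l<k. \<not> d l \<omega>)) \<longleftrightarrow> (\<forall>l\<le>k. d l \<omega> = (l = k))" for \<omega>
    by (metis less_irrefl order_le_less)
  then have "{\<omega>\<in>space M. d k \<omega> \<and> (\<forall>l<k. \<not> d l \<omega>)} = (\<Inter>l\<in>{..k}. d l -` ?A l \<inter> space M)"
    by (simp only: vimage_singleton_eq Int_iff set_eq_iff INT_iff atMost_iff mem_Collect_eq) auto
  also have "prob \<dots> = (\<Prod>l\<in>{..k}. prob (d l -` ?A l \<inter> space M))"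
    by (rule indep_varsD[OF ind]) auto
  also have "\<dots> = (\<Prod>l\<in>{..k}. if l = k then \<alpha> else 1 - \<alpha>)"
  proof (rule prod.cong)
    fix l
    have "{\<omega>\<in>space M. \<not> d l \<omega>} = space M - {\<omega>\<in>space M. d l \<omega>}" by auto
    then have "prob {\<omega>\<in>space M. \<not> d l \<omega>} = 1 - \<alpha>"
      using prob_compl[of "{\<omega>\<in>space M. d l \<omega>}"] prob[of l] by simp
    moreover have "d l -` ?A l \<inter> space M = (if l = k then {\<omega>\<in>space M. d l \<omega>} else {\<omega>\<in>space M. \<not> d l \<omega>})"
      by auto
    ultimately show "prob (d l -` ?A l \<inter> space M) = (if l = k then \<alpha> else 1 - \<alpha>)"
      using prob by simp
  qed simp
  also have "\<dots> = \<alpha> * (1 - \<alpha>) ^ k"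
    by (simp add: lessThan_Suc_atMost[symmetric])
  finally show ?thesis .
qed

text \<open>The events of a first success at index \<open>k\<close> are disjoint and their geometric
  probabilities sum to 1. Thus the value \<open>\<infinity>\<close> of \<open>bid_time\<close>
  occurs only on a null set.\<close>

lemma AE_ex_success: "AE \<omega> in M. \<exists>k. d k \<omega>"
proof -
  note [measurable] = measurable_trial
  let ?E = "\<lambda>k. {\<omega>\<in>space M. d k \<omega> \<and> (\<forall>l<k. \<not> d l \<omega>)}"
  have "disjoint_family ?E"
    unfolding disjoint_family_on_def by (auto, metis nat_neq_iff)
  then have "(\<lambda>k. prob (?E k)) sums prob (\<Union>k. ?E k)"
    by (intro finite_measure_UNION) auto
  moreover have "(\<lambda>k. \<alpha> * (1 - \<alpha>) ^ k) sums (\<alpha> * (1 / (1 - (1 - \<alpha>))))"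
    using \<alpha> by (intro sums_mult geometric_sums) auto
  ultimately have "prob (\<Union>k. ?E k) = 1"
    using \<alpha> unfolding prob_first_success by (auto dest: sums_unique2)
  then have "AE \<omega> in M. \<omega> \<in> (\<Union>k. ?E k)"
    by (subst (asm) prob_eq_1) auto
  then show ?thesis by eventually_elim auto
qed

lemma nn_integral_first_success:
  "(\<integral>\<^sup>+ \<omega>. h (LEAST k. d k \<omega>) \<partial>M) = (\<Sum>k. ennreal (\<alpha> * (1 - \<alpha>) ^ k) * h k)"
proof -
  note [measurable] = measurable_trial
  let ?E = "\<lambda>k. {\<omega>\<in>space M. d k \<omega> \<and> (\<forall>l<k. \<not> d l \<omega>)}"
  have "(\<integral>\<^sup>+ \<omega>. h (LEAST k. d k \<omega>) \<partial>M) = (\<integral>\<^sup>+ \<omega>. (\<Sum>k. h k * indicator (?E k) \<omega>) \<partial>M)"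
  proof (rule nn_integral_cong_AE)
    show "AE \<omega> in M. h (LEAST k. d k \<omega>) = (\<Sum>k. h k * indicator (?E k) \<omega>)"
      using AE_ex_success AE_space
    proof eventually_elim
      case (elim \<omega>)
      let ?k = "LEAST k. d k \<omega>"
      have k: "d ?k \<omega>" "\<And>l. l < ?k \<Longrightarrow> \<not> d l \<omega>"
        using elim(1) by (auto intro: LeastI_ex dest: not_less_Least)
      have "\<omega> \<in> ?E k \<longleftrightarrow> k = ?k" for k
        using k elim(2) linorder_neqE_nat[of k ?k] by blast
      then have *: "(\<lambda>k. h k * indicator (?E k) \<omega>) = (\<lambda>k. if k = ?k then h k else 0)"
        by (intro ext) (simp only: indicator_def if_distrib[of "\<lambda>x. _ * x"] of_bool_def mult_1_right mult_zero_right)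
      then show ?case
        unfolding * by (intro sums_unique sums_single)
    qed
  qed
  also have "\<dots> = (\<Sum>k. h k * emeasure M (?E k))"
    by (subst nn_integral_suminf) (auto intro!: suminf_cong nn_integral_cmult_indicator)
  finally show ?thesis
    by (simp add: emeasure_eq_measure prob_first_success mult.commute)
qed

end

text \<open>Independence of the generated sigma-algebras makes the joint law agree with the product
  law on rectangles, and Tonelli applies. Both integrals on the right run over \<open>M\<close>, so
  that \<open>X\<close> can be frozen at \<omega>' while \<open>Y\<close> keeps its original
  law.\<close>

lemma nn_integral_indep_set:
  assumes X: "X \<in> measurable M A" and Y: "Y \<in> measurable M B"
    and ind: "indep_set (sets (vimage_algebra (space M) X A)) (sets (vimage_algebra (space M) Y B))"
    and f: "f \<in> borel_measurable (A \<Otimes>\<^sub>M B)"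
  shows "(\<integral>\<^sup>+ \<omega>. f (X \<omega>, Y \<omega>) \<partial>M) = (\<integral>\<^sup>+ \<omega>'. (\<integral>\<^sup>+ \<omega>. f (X \<omega>', Y \<omega>) \<partial>M) \<partial>M)"
proof -
  note [measurable] = X Y f
  interpret X: prob_space "distr M A X" by (rule prob_space_distr) fact
  interpret Y: prob_space "distr M B Y" by (rule prob_space_distr) fact
  have eq: "distr M A X \<Otimes>\<^sub>M distr M B Y = distr M (A \<Otimes>\<^sub>M B) (\<lambda>\<omega>. (X \<omega>, Y \<omega>))"
  proof (rule pair_measure_eqI)
    fix a b assume ab: "a \<in> sets (distr M A X)" "b \<in> sets (distr M B Y)"
    have "prob ((X -` a \<inter> space M) \<inter> (Y -` b \<inter> space M)) = prob (X -` a \<inter> space M) * prob (Y -` b \<inter> space M)"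
      using ab by (intro indep_setD[OF ind] in_vimage_algebra) auto
    moreover have "(\<lambda>\<omega>. (X \<omega>, Y \<omega>)) -` (a \<times> b) \<inter> space M = (X -` a \<inter> space M) \<inter> (Y -` b \<inter> space M)"
      by auto
    ultimately show "emeasure (distr M A X) a * emeasure (distr M B Y) b =
        emeasure (distr M (A \<Otimes>\<^sub>M B) (\<lambda>\<omega>. (X \<omega>, Y \<omega>))) (a \<times> b)"
      using ab by (simp add: emeasure_distr emeasure_eq_measure ennreal_mult)
  qed (auto intro: X.sigma_finite_measure_axioms Y.sigma_finite_measure_axioms)
  have "(\<integral>\<^sup>+ \<omega>. f (X \<omega>, Y \<omega>) \<partial>M) = (\<integral>\<^sup>+ p. f p \<partial>(distr M A X \<Otimes>\<^sub>M distr M B Y))"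
    unfolding eq by (subst nn_integral_distr) auto
  also have "\<dots> = (\<integral>\<^sup>+ x. \<integral>\<^sup>+ y. f (x, y) \<partial>distr M B Y \<partial>distr M A X)"
    by (rule Y.nn_integral_fst[symmetric]) simp
  also have "\<dots> = (\<integral>\<^sup>+ \<omega>'. \<integral>\<^sup>+ y. f (X \<omega>', y) \<partial>distr M B Y \<partial>M)"
    by (subst nn_integral_distr) auto
  also have "\<dots> = (\<integral>\<^sup>+ \<omega>'. (\<integral>\<^sup>+ \<omega>. f (X \<omega>', Y \<omega>) \<partial>M) \<partial>M)"
    using measurable_space[OF X] by (intro nn_integral_cong, subst nn_integral_distr) auto
  finally show ?thesis .
qed

end

section \<open>Replacing bids by arrivals\<close>

text \<open>Used for products over \<open>i < K \<omega>\<close>: on each event where the count is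
  fixed, the product has a fixed number of factors.\<close>

lemma nn_integral_split_nat:
  fixes N :: "'a \<Rightarrow> nat"
  assumes N: "N \<in> measurable M (count_space UNIV)"
    and h: "\<And>k. h k \<in> borel_measurable M"
  shows "(\<integral>\<^sup>+ \<omega>. h (N \<omega>) \<omega> \<partial>M) = (\<Sum>k. \<integral>\<^sup>+ \<omega>. indicator {k} (N \<omega>) * h k \<omega> \<partial>M)"
proof -
  have [measurable]: "(\<lambda>\<omega>. indicator {k} (N \<omega>) :: ennreal) \<in> borel_measurable M" for k
    by (rule measurable_compose[OF N]) simp
  have "h (N \<omega>) \<omega> = (\<Sum>k. indicator {k} (N \<omega>) * h k \<omega>)" for \<omega>
  proof -
    have *: "(\<lambda>k. indicator {k} (N \<omega>) * h k \<omega>) = (\<lambda>k. if k = N \<omega> then h k \<omega> else 0)"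
      by (auto simp: fun_eq_iff)
    show ?thesis unfolding * by (intro sums_unique sums_single)
  qed
  then show ?thesis
    using h by (simp only:) (intro nn_integral_suminf, measurable)
qed

text \<open>The interval is empty here, and \<open>uniform_measure\<close> on an empty set is the
  zero measure.\<close>

lemma unif_mean_eq_0:
  assumes "f \<in> borel_measurable borel" "T \<le> x"
  shows "unif_mean T f x = 0"
  using assms by (simp add: unif_mean_eq)

lemma subalgebra_vimage_algebra:
  assumes "f \<in> measurable M N"
  shows "subalgebra M (vimage_algebra (space M) f N)"
  using assms measurable_space[OF assms] measurable_sets[OF assms]
  by (auto simp: subalgebra_def sets_vimage_algebra2)

lemma measurable_vimage_algebra_compose:
  assumes "f \<in> measurable M N" "g \<in> measurable N L" "\<And>x. x \<in> space M \<Longrightarrow> h x = g (f x)"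
  shows "h \<in> measurable (vimage_algebra (space M) f N) L"
proof -
  have "(\<lambda>x. g (f x)) \<in> measurable (vimage_algebra (space M) f N) L"
    using assms measurable_space[OF assms(1)]
    by (intro measurable_compose[OF measurable_vimage_algebra1]) auto
  then show ?thesis
    using assms(3) by (subst measurable_cong[where g="\<lambda>x. g (f x)"]) auto
qed

section \<open>One bidder: from the bid back to the arrival\<close>

context bidder begin

lemma nn_integral_potential_bid:
  assumes [measurable]: "f \<in> borel_measurable borel"
  shows "(\<integral>\<^sup>+ \<omega>. f (s k \<omega>) \<partial>M) = (\<integral>\<^sup>+ \<omega>. (unif_mean T ^^ k) f (s 0 \<omega>) \<partial>M)"
proof -
  let ?V = "\<lambda>k \<omega>. \<lambda>l\<in>{..k}. s l \<omega>"
  let ?F = "\<lambda>k. vimage_algebra (space M) (?V k) (PiM {..k} (\<lambda>_. borel))"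
  note [measurable] = time_measurable
  have V: "?V k \<in> measurable M (PiM {..k} (\<lambda>_. borel))" for k
    by measurable
  have "(\<integral>\<^sup>+ \<omega>. 1 * f (s k \<omega>) \<partial>M) = (\<integral>\<^sup>+ \<omega>. 1 * (unif_mean T ^^ k) f (s 0 \<omega>) \<partial>M)"
  proof (rule nn_integral_cond_uniform_chain[where F = ?F and E = "\<lambda>_. True"])
    show "s k \<in> borel_measurable (?F k)" for k
      by (rule measurable_vimage_algebra_compose[OF V, of "\<lambda>x. x k"]) auto
  qed (auto intro: subalgebra_vimage_algebra[OF V] next_time)
  then show ?thesis by simp
qed

text \<open>With the decisions frozen, the index of the bid is a constant and the chain can be
  pulled back to the arrival. Averaging over the geometric index then produces the series whose
  value is \<open>g\<close>.\<close>

lemma nn_integral_bid: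
  assumes \<alpha>: "0 < \<alpha>" "\<alpha> \<le> 1"
    and [measurable]: "w \<in> borel_measurable borel" "g \<in> borel_measurable borel"
    and g1: "\<And>x. g x \<le> 1"
    and fixp: "\<And>x. x < T \<Longrightarrow> g x = ennreal \<alpha> * w x + ennreal (1 - \<alpha>) * unif_mean T g x"
    and arr: "AE \<omega> in M. s 0 \<omega> < T"
  shows "(\<integral>\<^sup>+ \<omega>. w (s (LEAST k. d k \<omega>) \<omega>) \<partial>M) = (\<integral>\<^sup>+ \<omega>. g (s 0 \<omega>) \<partial>M)"
proof -
  note [measurable] = time_measurable measurable_trial[OF decisions_indep decision_prob \<alpha>]
  let ?A = "PiM UNIV (\<lambda>_. count_space UNIV) :: (nat \<Rightarrow> bool) measure"
  let ?B = "PiM UNIV (\<lambda>_. borel) :: (nat \<Rightarrow> real) measure"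
  let ?f = "\<lambda>p. w (snd p (LEAST k. fst p k))"
  have [measurable]: "(\<lambda>p. snd p (LEAST k. fst p k)) \<in> borel_measurable (?A \<Otimes>\<^sub>M ?B)"
    by (rule measurable_compose_countable[where f="\<lambda>k p. snd p k"]) auto
  have "(\<integral>\<^sup>+ \<omega>. w (s (LEAST k. d k \<omega>) \<omega>) \<partial>M) = (\<integral>\<^sup>+ \<omega>. ?f (\<lambda>k. d k \<omega>, \<lambda>k. s k \<omega>) \<partial>M)"
    by simp
  also have "\<dots> = (\<integral>\<^sup>+ \<omega>'. (\<integral>\<^sup>+ \<omega>. ?f (\<lambda>k. d k \<omega>', \<lambda>k. s k \<omega>) \<partial>M) \<partial>M)"
    by (rule nn_integral_indep_set[OF _ _ decisions_indep_times]) (auto intro!: measurable_PiM_single')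
  also have "\<dots> = (\<integral>\<^sup>+ \<omega>'. (\<integral>\<^sup>+ \<omega>. (unif_mean T ^^ (LEAST k. d k \<omega>')) w (s 0 \<omega>) \<partial>M) \<partial>M)"
    by (simp only: fst_conv snd_conv nn_integral_potential_bid[OF assms(3), of "LEAST k. d k \<omega>'" for \<omega>'])
  also have "\<dots> = (\<Sum>k. ennreal (\<alpha> * (1 - \<alpha>) ^ k) * (\<integral>\<^sup>+ \<omega>. (unif_mean T ^^ k) w (s 0 \<omega>) \<partial>M))"
    by (rule nn_integral_first_success[OF decisions_indep decision_prob \<alpha>])
  also have "\<dots> = (\<integral>\<^sup>+ \<omega>. (\<Sum>k. ennreal (\<alpha> * (1 - \<alpha>) ^ k) * (unif_mean T ^^ k) w (s 0 \<omega>)) \<partial>M)"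
    by (subst nn_integral_suminf) (auto intro!: suminf_cong nn_integral_cmult[symmetric])
  also have "\<dots> = (\<integral>\<^sup>+ \<omega>. g (s 0 \<omega>) \<partial>M)"
  proof (rule nn_integral_cong_AE)
    show "AE \<omega> in M. (\<Sum>k. ennreal (\<alpha> * (1 - \<alpha>) ^ k) * (unif_mean T ^^ k) w (s 0 \<omega>)) = g (s 0 \<omega>)"
      using arr by eventually_elim (rule suminf_geometric_unif_mean[OF \<alpha> _ _ g1 fixp]; simp)
  qed
  finally show ?thesis .
qed

end

section \<open>Many bidders: from all bids back to all arrivals\<close>

context bidder_population begin

lemma measurable_decision: "D i k \<in> measurable M (count_space UNIV)"
proof -
  have "(case (i, k) of (i, k) \<Rightarrow> D i k) \<in> measurable M (count_space UNIV)"
    using decisions_indep unfolding indep_vars_def2 by blast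
  then show ?thesis by simp
qed

lemma indep_decisions_row: "indep_vars (\<lambda>_. count_space UNIV) (D i) UNIV"
  unfolding indep_vars_def2
proof (intro conjI ballI indep_setsI measurable_decision)
  have ind: "indep_sets (\<lambda>p. {(case p of (i, k) \<Rightarrow> D i k) -` A \<inter> space M |A. A \<in> sets (count_space UNIV)}) UNIV"
    using decisions_indep unfolding indep_vars_def2 by blast
  fix A J assume J: "J \<noteq> {}" "finite J"
    and A: "\<forall>j\<in>J. A j \<in> {D i j -` A \<inter> space M |A. A \<in> sets (count_space UNIV)}"
  have "prob (\<Inter>p\<in>Pair i ` J. A (snd p)) = (\<Prod>p\<in>Pair i ` J. prob (A (snd p)))"
    using J A by (intro indep_setsD[OF ind]) auto
  then show "prob (\<Inter>j\<in>J. A j) = (\<Prod>j\<in>J. prob (A j))"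
    by (simp add: prod.reindex inj_on_def)
qed (use measurable_decision in auto)

definition first_bid :: "nat \<Rightarrow> 'a \<Rightarrow> nat" where
  "first_bid i \<omega> = (LEAST k. D i k \<omega>)"

lemma measurable_first_bid: "first_bid i \<in> measurable M (count_space UNIV)"
proof -
  note [measurable] = measurable_decision
  show ?thesis unfolding first_bid_def by measurable
qed

text \<open>The indices \<open>first_bid i\<close> depend on disjoint rows of the decision array, so
  they are independent and the expectation factors.\<close>

lemma nn_integral_prod_first_bid:
  assumes \<alpha>: "0 < \<alpha>" "\<alpha> \<le> 1"
  shows "(\<integral>\<^sup>+ \<omega>. (\<Prod>i<n. h i (first_bid i \<omega>)) \<partial>M) = (\<Prod>i<n. \<Sum>k. ennreal (\<alpha> * (1 - \<alpha>) ^ k) * (h i k :: ennreal))"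
proof -
  let ?R = "\<lambda>i. range (Pair i) :: (nat \<times> nat) set"
  have "indep_vars (\<lambda>i. PiM (?R i) (\<lambda>_. count_space UNIV))
      (\<lambda>i \<omega>. restrict (\<lambda>p. (case p of (i, k) \<Rightarrow> D i k) \<omega>) (?R i)) {..<n}"
    by (rule indep_vars_restrict[OF decisions_indep]) (auto simp: disjoint_family_on_def)
  then have "indep_vars (\<lambda>_. borel) (\<lambda>i \<omega>. (\<lambda>r. h i (LEAST k. r (i, k))) (restrict (\<lambda>p. (case p of (i, k) \<Rightarrow> D i k) \<omega>) (?R i))) {..<n}"
  proof (rule indep_vars_compose2)
    fix i
    have [measurable]: "(\<lambda>r. r (i, k)) \<in> measurable (PiM (?R i) (\<lambda>_. count_space UNIV)) (count_space UNIV)" for k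
      by (rule measurable_component_singleton) simp
    have "(\<lambda>r. LEAST k. r (i, k)) \<in> measurable (PiM (?R i) (\<lambda>_. count_space UNIV)) (count_space UNIV)"
      by measurable
    then show "(\<lambda>r. h i (LEAST k. r (i, k))) \<in> borel_measurable (PiM (?R i) (\<lambda>_. count_space UNIV))"
      by (rule measurable_compose) simp
  qed
  then have "indep_vars (\<lambda>_. borel) (\<lambda>i \<omega>. h i (first_bid i \<omega>)) {..<n}"
    by (simp add: first_bid_def)
  then have "(\<integral>\<^sup>+ \<omega>. (\<Prod>i<n. h i (first_bid i \<omega>)) \<partial>M) = (\<Prod>i<n. \<integral>\<^sup>+ \<omega>. h i (first_bid i \<omega>) \<partial>M)"
    by (intro indep_vars_nn_integral) auto
  also have "\<dots> = (\<Prod>i<n. \<Sum>k. ennreal (\<alpha> * (1 - \<alpha>) ^ k) * h i k)"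
    unfolding first_bid_def
    by (intro prod.cong refl nn_integral_first_success[OF indep_decisions_row decision_prob \<alpha>])
  finally show ?thesis .
qed

definition information :: "nat \<Rightarrow> nat \<Rightarrow> 'a measure" where
  "information i k = vimage_algebra (space M)
     (\<lambda>\<omega>. (K \<omega>, \<lambda>(j, l)\<in>{(j, l). j \<noteq> i \<or> l \<le> k}. S j l \<omega>))
     (count_space UNIV \<Otimes>\<^sub>M PiM {(j, l). j \<noteq> i \<or> l \<le> k} (\<lambda>_. borel))"

lemma
  shows subalgebra_information: "subalgebra M (information i k)"
    and measurable_time_information: "j \<noteq> i \<or> l \<le> k \<Longrightarrow> S j l \<in> borel_measurable (information i k)"
    and measurable_number_information: "K \<in> measurable (information i k) (count_space UNIV)"
proof -
  have V: "(\<lambda>\<omega>. (K \<omega>, \<lambda>(j, l)\<in>{(j, l). j \<noteq> i \<or> l \<le> k}. S j l \<omega>))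
      \<in> measurable M (count_space UNIV \<Otimes>\<^sub>M PiM {(j, l). j \<noteq> i \<or> l \<le> k} (\<lambda>_. borel))"
    using time_measurable by (intro measurable_Pair number_measurable measurable_restrict) auto
  show "subalgebra M (information i k)"
    unfolding information_def by (rule subalgebra_vimage_algebra[OF V])
  show "S j l \<in> borel_measurable (information i k)" if "j \<noteq> i \<or> l \<le> k"
    unfolding information_def using that
    by (intro measurable_vimage_algebra_compose[OF V, of "\<lambda>x. snd x (j, l)"]) auto
  show "K \<in> measurable (information i k) (count_space UNIV)"
    unfolding information_def by (rule measurable_vimage_algebra_compose[OF V, of fst]) auto
qed

lemma nn_integral_potential_bid:
  assumes i: "i < n" and f: "f \<in> borel_measurable borel"
    and X: "\<And>k. X \<in> borel_measurable (information i k)"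
    and X0: "\<And>\<omega>. K \<omega> \<noteq> n \<Longrightarrow> X \<omega> = (0::ennreal)"
  shows "(\<integral>\<^sup>+ \<omega>. X \<omega> * f (S i k \<omega>) \<partial>M) = (\<integral>\<^sup>+ \<omega>. X \<omega> * (unif_mean T ^^ k) f (S i 0 \<omega>) \<partial>M)"
proof (rule nn_integral_cond_uniform_chain[where F = "information i" and E = "\<lambda>\<omega>. i < K \<omega>"])
  show "cond_uniform M (information i k) (\<lambda>\<omega>. i < K \<omega>) (S i (Suc k)) (S i k) T" for k
    unfolding information_def by (rule next_time)
  show "X \<omega> = 0" if "\<not> i < K \<omega>" for \<omega>
    using that i by (intro X0) auto
qed (auto intro: subalgebra_information measurable_time_information X f)

text \<open>The induction is over the set \<open>J\<close> of bidders already pulled back. When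
  bidder \<open>i\<close> is treated, every other factor depends only on \<open>K\<close> and the
  times of bidders \<open>j \<noteq> i\<close>, whether already pulled back or not, and is therefore
  measurable for \<open>information i k\<close> at every \<open>k\<close>.\<close>

lemma nn_integral_prod_potential_bids:
  assumes [measurable]: "w \<in> borel_measurable borel"
  shows "(\<integral>\<^sup>+ \<omega>. indicator {n} (K \<omega>) * (\<Prod>i<n. w (S i (c i) \<omega>)) \<partial>M)
       = (\<integral>\<^sup>+ \<omega>. indicator {n} (K \<omega>) * (\<Prod>i<n. (unif_mean T ^^ c i) w (S i 0 \<omega>)) \<partial>M)"
proof -
  let ?u = "\<lambda>J i \<omega>. if i \<in> J then (unif_mean T ^^ c i) w (S i 0 \<omega>) else w (S i (c i) \<omega>)"
  have "(\<integral>\<^sup>+ \<omega>. indicator {n} (K \<omega>) * (\<Prod>i<n. ?u J i \<omega>) \<partial>M)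
       = (\<integral>\<^sup>+ \<omega>. indicator {n} (K \<omega>) * (\<Prod>i<n. w (S i (c i) \<omega>)) \<partial>M)"
    if "finite J" "J \<subseteq> {..<n}" for J
    using that
  proof (induction J rule: finite_induct)
    case (insert i J)
    let ?X = "\<lambda>\<omega>. indicator {n} (K \<omega>) * (\<Prod>j\<in>{..<n}-{i}. ?u J j \<omega>) :: ennreal"
    have i: "i < n" using insert by auto
    have X: "?X \<in> borel_measurable (information i k)" for k
    proof (intro borel_measurable_times_ennreal borel_measurable_prod_ennreal)
      show "(\<lambda>\<omega>. indicator {n} (K \<omega>) :: ennreal) \<in> borel_measurable (information i k)"
        by (rule measurable_compose[OF measurable_number_information]) simp
      fix j assume "j \<in> {..<n} - {i}"
      then have [measurable]: "S j l \<in> borel_measurable (information i k)" for l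
        by (intro measurable_time_information) auto
      show "?u J j \<in> borel_measurable (information i k)"
        by (cases "j \<in> J") auto
    qed
    have r: "(\<Prod>j<n. v j) = (\<Prod>j\<in>{..<n}-{i}. v j) * v i" for v :: "nat \<Rightarrow> ennreal"
      using i by (subst prod.remove[of _ i]) (auto simp: mult.commute)
    have "(\<integral>\<^sup>+ \<omega>. indicator {n} (K \<omega>) * (\<Prod>j<n. ?u (insert i J) j \<omega>) \<partial>M)
      = (\<integral>\<^sup>+ \<omega>. ?X \<omega> * (unif_mean T ^^ c i) w (S i 0 \<omega>) \<partial>M)"
      unfolding r by (auto intro!: nn_integral_cong prod.cong simp: mult.assoc)
    also have "\<dots> = (\<integral>\<^sup>+ \<omega>. ?X \<omega> * w (S i (c i) \<omega>) \<partial>M)"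
      by (rule nn_integral_potential_bid[OF i _ X, symmetric]) (auto simp: indicator_def)
    also have "\<dots> = (\<integral>\<^sup>+ \<omega>. indicator {n} (K \<omega>) * (\<Prod>j<n. ?u J j \<omega>) \<partial>M)"
      unfolding r using insert by (auto intro!: nn_integral_cong simp: mult.assoc)
    finally show ?case using insert by simp
  qed simp
  from this[of "{..<n}"] show ?thesis by simp
qed

text \<open>\<open>arrival_range\<close> alone would allow an arrival at \<open>T\<close>. From a
  point at or beyond \<open>T\<close> the kernel is the zero measure, whereas integrating the
  constant 1 against a conditional law must reproduce the mass; comparing the two shows that the
  event is null.\<close>

lemma AE_arrival_less: "AE \<omega> in M. \<forall>i<K \<omega>. S i 0 \<omega> < T"
proof -
  note [measurable] = time_measurable number_measurable
  have "AE \<omega> in M. K \<omega> = n \<longrightarrow> S i 0 \<omega> < T" if i: "i < n" for i n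
  proof -
    let ?X = "\<lambda>\<omega>. indicator ({\<omega>. K \<omega> = n \<and> T \<le> S i 0 \<omega>}) \<omega> :: ennreal"
    have "?X \<in> borel_measurable (information i k)" for k
    proof -
      have [measurable]: "S i 0 \<in> borel_measurable (information i k)"
        by (rule measurable_time_information) simp
      note [measurable] = measurable_number_information
      have "Measurable.pred (information i k) (\<lambda>\<omega>. K \<omega> = n \<and> T \<le> S i 0 \<omega>)"
        by measurable
      then show ?thesis
        by (intro borel_measurable_indicator') (auto simp: pred_def)
    qed
    then have "(\<integral>\<^sup>+ \<omega>. ?X \<omega> * 1 \<partial>M) = (\<integral>\<^sup>+ \<omega>. ?X \<omega> * (unif_mean T ^^ 1) (\<lambda>_. 1) (S i 0 \<omega>) \<partial>M)"
      using i by (intro nn_integral_potential_bid[where f="\<lambda>_. 1" and k=1]) (auto simp: indicator_def)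
    also have "\<dots> = (\<integral>\<^sup>+ \<omega>. 0 \<partial>M)"
      by (intro nn_integral_cong) (auto simp: indicator_def unif_mean_eq_0)
    finally have "AE \<omega> in M. ?X \<omega> = 0"
      by (intro nn_integral_0_iff_AE[THEN iffD1]) auto
    then show ?thesis by eventually_elim (auto simp: indicator_def not_le split: if_splits)
  qed
  then have "AE \<omega> in M. \<forall>n i. i < n \<longrightarrow> K \<omega> = n \<longrightarrow> S i 0 \<omega> < T"
    unfolding AE_all_countable by auto
  then show ?thesis by eventually_elim auto
qed

text \<open>\<open>g\<close> may be any solution bounded by 1 for the weight \<open>w\<close>; later
  \<open>w\<close> is a step function and \<open>g\<close> is known in closed form.\<close>

lemma nn_integral_prod_bids:
  assumes \<alpha>: "0 < \<alpha>" "\<alpha> \<le> 1"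
    and [measurable]: "w \<in> borel_measurable borel" "g \<in> borel_measurable borel"
    and g1: "\<And>x. g x \<le> 1"
    and fixp: "\<And>x. x < T \<Longrightarrow> g x = ennreal \<alpha> * w x + ennreal (1 - \<alpha>) * unif_mean T g x"
  shows "(\<integral>\<^sup>+ \<omega>. (\<Prod>i<K \<omega>. w (S i (first_bid i \<omega>) \<omega>)) \<partial>M) = (\<integral>\<^sup>+ \<omega>. (\<Prod>i<K \<omega>. g (S i 0 \<omega>)) \<partial>M)"
proof -
  note [measurable] = time_measurable number_measurable measurable_decision measurable_first_bid
  have [measurable]: "(\<lambda>\<omega>. S i (first_bid i \<omega>) \<omega>) \<in> borel_measurable M" for i
    by (rule measurable_compose_countable[where f="\<lambda>k. S i k"]) auto
  have [measurable]: "(\<lambda>\<omega>. indicator {n} (K \<omega>) :: ennreal) \<in> borel_measurable M" for n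
    by (rule measurable_compose[OF number_measurable]) simp
  have split: "(\<integral>\<^sup>+ \<omega>. (\<Prod>i<K \<omega>. v i \<omega>) \<partial>M) = (\<Sum>n. \<integral>\<^sup>+ \<omega>. indicator {n} (K \<omega>) * (\<Prod>i<n. v i \<omega>) \<partial>M)"
    if [measurable]: "\<And>i. v i \<in> borel_measurable M" for v :: "nat \<Rightarrow> 'a \<Rightarrow> ennreal"
    by (rule nn_integral_split_nat[OF number_measurable]) measurable
  let ?A = "PiM UNIV (\<lambda>_. count_space UNIV) :: (nat \<times> nat \<Rightarrow> bool) measure"
  let ?B = "count_space UNIV \<Otimes>\<^sub>M PiM UNIV (\<lambda>_. borel) :: (nat \<times> (nat \<times> nat \<Rightarrow> real)) measure"
  have "(\<integral>\<^sup>+ \<omega>. indicator {n} (K \<omega>) * (\<Prod>i<n. w (S i (first_bid i \<omega>) \<omega>)) \<partial>M)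
      = (\<integral>\<^sup>+ \<omega>. indicator {n} (K \<omega>) * (\<Prod>i<n. g (S i 0 \<omega>)) \<partial>M)" for n
  proof -
    let ?f = "\<lambda>p. indicator {n} (fst (snd p)) * (\<Prod>i<n. w (snd (snd p) (i, LEAST k. fst p (i, k)))) :: ennreal"
    have [measurable]: "(\<lambda>p. snd (snd p) (i, LEAST k. fst p (i, k))) \<in> borel_measurable (?A \<Otimes>\<^sub>M ?B)" for i
      by (rule measurable_compose_countable[where f="\<lambda>k p. snd (snd p) (i, k)"]) auto
    have [measurable]: "(\<lambda>p. indicator {n} (fst (snd p)) :: ennreal) \<in> borel_measurable (?A \<Otimes>\<^sub>M ?B)"
      by (rule measurable_compose[where g="indicator {n}" and N="count_space UNIV"]) auto
    have f: "?f \<in> borel_measurable (?A \<Otimes>\<^sub>M ?B)"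
      by (intro borel_measurable_times_ennreal borel_measurable_prod_ennreal) auto
    have m1: "(\<lambda>\<omega> (i, k). D i k \<omega>) \<in> measurable M ?A"
      by (rule measurable_PiM_single') auto
    have m2: "(\<lambda>\<omega>. (K \<omega>, \<lambda>(i, k). S i k \<omega>)) \<in> measurable M ?B"
      by (intro measurable_Pair number_measurable measurable_PiM_single') auto
    have "(\<integral>\<^sup>+ \<omega>. indicator {n} (K \<omega>) * (\<Prod>i<n. w (S i (first_bid i \<omega>) \<omega>)) \<partial>M)
      = (\<integral>\<^sup>+ \<omega>. ?f (\<lambda>(i, k). D i k \<omega>, (K \<omega>, \<lambda>(i, k). S i k \<omega>)) \<partial>M)"
      by (simp add: first_bid_def)
    also have "\<dots> = (\<integral>\<^sup>+ \<omega>'. (\<integral>\<^sup>+ \<omega>. ?f (\<lambda>(i, k). D i k \<omega>', (K \<omega>, \<lambda>(i, k). S i k \<omega>)) \<partial>M) \<partial>M)"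
      by (rule nn_integral_indep_set[OF m1 m2 decisions_indep_times f])
    also have "\<dots> = (\<integral>\<^sup>+ \<omega>'. (\<integral>\<^sup>+ \<omega>. indicator {n} (K \<omega>) * (\<Prod>i<n. w (S i (first_bid i \<omega>') \<omega>)) \<partial>M) \<partial>M)"
      by (simp add: first_bid_def)
    also have "\<dots> = (\<integral>\<^sup>+ \<omega>'. (\<integral>\<^sup>+ \<omega>. indicator {n} (K \<omega>) * (\<Prod>i<n. (unif_mean T ^^ first_bid i \<omega>') w (S i 0 \<omega>)) \<partial>M) \<partial>M)"
      by (intro nn_integral_cong nn_integral_prod_potential_bids) auto
    \<comment> \<open>Swapping the integrals fixes the arrival times first; the remaining inner
      integral concerns decisions only, so it factors over the bidders.\<close>
    also have "\<dots> = (\<integral>\<^sup>+ \<omega>. (\<integral>\<^sup>+ \<omega>'. indicator {n} (K \<omega>) * (\<Prod>i<n. (unif_mean T ^^ first_bid i \<omega>') w (S i 0 \<omega>)) \<partial>M) \<partial>M)"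
    proof -
      interpret P: pair_sigma_finite M M ..
      have [measurable]: "(\<lambda>p. (unif_mean T ^^ first_bid i (fst p)) w (S i 0 (snd p))) \<in> borel_measurable (M \<Otimes>\<^sub>M M)" for i
        by (rule measurable_compose_countable[where f="\<lambda>k p. (unif_mean T ^^ k) w (S i 0 (snd p))"]) auto
      show ?thesis
        by (rule P.Fubini'[symmetric]) (simp add: split_beta)
    qed
    also have "\<dots> = (\<integral>\<^sup>+ \<omega>. indicator {n} (K \<omega>) * (\<integral>\<^sup>+ \<omega>'. (\<Prod>i<n. (unif_mean T ^^ first_bid i \<omega>') w (S i 0 \<omega>)) \<partial>M) \<partial>M)"
    proof (intro nn_integral_cong nn_integral_cmult)
      fix \<omega>
      have [measurable]: "(\<lambda>\<omega>'. (unif_mean T ^^ first_bid i \<omega>') w (S i 0 \<omega>)) \<in> borel_measurable M" for i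
        by (rule measurable_compose_countable[where f="\<lambda>k p. (unif_mean T ^^ k) w (S i 0 \<omega>)"]) auto
      show "(\<lambda>\<omega>'. \<Prod>i<n. (unif_mean T ^^ first_bid i \<omega>') w (S i 0 \<omega>)) \<in> borel_measurable M"
        by measurable
    qed
    also have "\<dots> = (\<integral>\<^sup>+ \<omega>. indicator {n} (K \<omega>) * (\<Prod>i<n. \<Sum>k. ennreal (\<alpha> * (1 - \<alpha>) ^ k) * (unif_mean T ^^ k) w (S i 0 \<omega>)) \<partial>M)"
      by (subst nn_integral_prod_first_bid[OF \<alpha>]) simp
    also have "\<dots> = (\<integral>\<^sup>+ \<omega>. indicator {n} (K \<omega>) * (\<Prod>i<n. g (S i 0 \<omega>)) \<partial>M)"
    proof (rule nn_integral_cong_AE)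
      show "AE \<omega> in M. indicator {n} (K \<omega>) * (\<Prod>i<n. \<Sum>k. ennreal (\<alpha> * (1 - \<alpha>) ^ k) * (unif_mean T ^^ k) w (S i 0 \<omega>))
          = indicator {n} (K \<omega>) * (\<Prod>i<n. g (S i 0 \<omega>))"
        using AE_arrival_less
      proof eventually_elim
        case (elim \<omega>)
        show ?case
        proof (cases "K \<omega> = n")
          case True
          then show ?thesis
            using elim by (intro arg_cong2[where f="(*)"] refl prod.cong suminf_geometric_unif_mean[OF \<alpha> _ _ g1 fixp]) auto
        qed simp
      qed
    qed
    finally show ?thesis .
  qed
  then show ?thesis
    by (simp add: split)
qed

end

section \<open>The law of the bid time given the arrival time\<close>

lemma unif_mean_ennreal:
  assumes [measurable]: "f \<in> borel_measurable borel" and f: "\<And>y. 0 \<le> f y" and x: "x < T"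
    and int: "has_bochner_integral lborel (\<lambda>y. indicator {x<..<T} y * f y) I"
  shows "unif_mean T (\<lambda>y. ennreal (f y)) x = ennreal (I / (T - x))" and "0 \<le> I"
proof -
  have "(\<integral>\<^sup>+ y. ennreal (f y) * indicator {x<..<T} y \<partial>lborel)
      = (\<integral>\<^sup>+ y. ennreal (indicator {x<..<T} y * f y) \<partial>lborel)"
    by (intro nn_integral_cong) (auto simp: indicator_def)
  also have "\<dots> = ennreal I"
    using int f by (subst nn_integral_eq_integral) (auto simp: has_bochner_integral_iff)
  finally have nn: "(\<integral>\<^sup>+ y. ennreal (f y) * indicator {x<..<T} y \<partial>lborel) = ennreal I" .
  show "0 \<le> I"
    unfolding has_bochner_integral_integral_eq[OF int, symmetric]
    using f by (intro Bochner_Integration.integral_nonneg) auto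
  then show "unif_mean T (\<lambda>y. ennreal (f y)) x = ennreal (I / (T - x))"
    using x nn by (simp add: unif_mean_eq divide_ennreal)
qed

definition bid_cdf :: "real \<Rightarrow> real \<Rightarrow> real \<Rightarrow> real \<Rightarrow> real" where
  "bid_cdf T \<alpha> t x = (if x \<le> t then 1 - (1 - \<alpha>) * ((T - t) / (T - x)) powr \<alpha> else 0)"

text \<open>The integral of \<open>bid_cdf T \<alpha> t\<close> over \<open>(x, T)\<close>. As a
  function \<open>G\<close> of \<open>x \<le> t\<close> it solves
  \<open>G' = - \<alpha> - (1 - \<alpha>) * G / (T - x)\<close> with \<open>G t = 0\<close>, which
  is the equation for \<open>g\<close> rewritten with \<open>g = - G'\<close>.\<close>

definition bid_cdf_integral :: "real \<Rightarrow> real \<Rightarrow> real \<Rightarrow> real \<Rightarrow> real" where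
  "bid_cdf_integral T \<alpha> t x = (if x \<le> t then (T - x) * (1 - ((T - t) / (T - x)) powr \<alpha>) else 0)"

lemma measurable_bid_cdf [measurable]: "bid_cdf T \<alpha> t \<in> borel_measurable borel"
  unfolding bid_cdf_def by measurable

locale bid_law =
  fixes T \<alpha> :: real
  assumes \<alpha>: "0 < \<alpha>" "\<alpha> \<le> 1"
begin

lemma bid_cdf_nonneg: "t \<le> T \<Longrightarrow> 0 \<le> bid_cdf T \<alpha> t x"
proof -
  assume t: "t \<le> T"
  have "((T - t) / (T - x)) powr \<alpha> \<le> 1" if "x \<le> t"
    using that t \<alpha> by (cases "x = T") (auto intro!: powr_le1)
  moreover have "(1 - \<alpha>) * p \<le> 1" if "0 \<le> p" "p \<le> 1" for p :: real
    using mult_mono[of "1 - \<alpha>" 1 p 1] \<alpha> that by simp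
  ultimately show ?thesis
    by (auto simp: bid_cdf_def)
qed

lemma bid_cdf_le_1: "bid_cdf T \<alpha> t x \<le> 1"
  using \<alpha> by (auto simp: bid_cdf_def)

lemma bid_cdf_mono:
  assumes "t \<le> u" "u \<le> T" shows "bid_cdf T \<alpha> t x \<le> bid_cdf T \<alpha> u x"
proof (cases "x \<le> t")
  case True
  have "((T - u) / (T - x)) powr \<alpha> \<le> ((T - t) / (T - x)) powr \<alpha>"
    using assms \<alpha> True by (intro powr_mono2 divide_right_mono) auto
  then show ?thesis
    using assms \<alpha> True by (simp add: bid_cdf_def mult_left_mono)
next
  case False
  then show ?thesis
    using bid_cdf_nonneg[OF assms(2), of x] by (simp add: bid_cdf_def)
qed

text \<open>For \<open>t < T\<close> there is a jump at \<open>x = t\<close> from \<alpha> to 0, and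
  the closed condition \<open>x \<le> t\<close> puts the value \<alpha> at the jump. Continuity from
  the left is the side that matters, because the step approximation samples at left endpoints of
  cells.\<close>

lemma bid_cdf_left_continuous:
  assumes "t \<le> T" "x \<le> T"
  shows "(bid_cdf T \<alpha> t \<longlongrightarrow> bid_cdf T \<alpha> t x) (at_left x)"
proof (cases "x \<le> t")
  case True
  have ev: "\<forall>\<^sub>F y in at_left x. 1 - (1 - \<alpha>) * ((T - t) / (T - y)) powr \<alpha> = bid_cdf T \<alpha> t y"
    using True by (auto simp: eventually_at_filter bid_cdf_def)
  show ?thesis
  \<comment> \<open>For \<open>t = T\<close> the function is constantly 1 up to \<open>T\<close>,
    but the limit of the quotient cannot be taken at \<open>x = T\<close>, where its denominator
    vanishes.\<close>
  proof (cases "t = T")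
    case True
    have "((\<lambda>y. 1 - (1 - \<alpha>) * ((T - t) / (T - y)) powr \<alpha>) \<longlongrightarrow> bid_cdf T \<alpha> t x) (at_left x)"
      using assms True by (simp add: bid_cdf_def)
    then show ?thesis by (rule Lim_transform_eventually) (rule ev)
  next
    case False
    then have "((\<lambda>y. 1 - (1 - \<alpha>) * ((T - t) / (T - y)) powr \<alpha>) \<longlongrightarrow> 1 - (1 - \<alpha>) * ((T - t) / (T - x)) powr \<alpha>) (at_left x)"
      using True assms by (intro tendsto_intros) auto
    then have "((\<lambda>y. 1 - (1 - \<alpha>) * ((T - t) / (T - y)) powr \<alpha>) \<longlongrightarrow> bid_cdf T \<alpha> t x) (at_left x)"
      using True by (simp add: bid_cdf_def)
    then show ?thesis by (rule Lim_transform_eventually) (rule ev)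
  qed
next
  case False
  then have "\<forall>\<^sub>F y in at_left x. t < y"
    by (intro eventually_at_leftI[of t]) auto
  then have "\<forall>\<^sub>F y in at_left x. 0 = bid_cdf T \<alpha> t y"
    by eventually_elim (simp add: bid_cdf_def)
  then have "(bid_cdf T \<alpha> t \<longlongrightarrow> 0) (at_left x)"
    by (rule Lim_transform_eventually[rotated]) simp
  then show ?thesis
    using False by (simp add: bid_cdf_def)
qed

lemma has_integral_bid_cdf:
  assumes "t \<le> T" "x < T"
  shows "has_bochner_integral lborel (\<lambda>y. indicator {x<..<T} y * bid_cdf T \<alpha> t y) (bid_cdf_integral T \<alpha> t x)"
proof (cases "x \<le> t")
  case x: True
  show ?thesis
  proof (cases "t = T")
    case True
    have "has_bochner_integral lborel (indicator {x<..<T} :: real \<Rightarrow> real) (measure lborel {x<..<T})"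
      using assms by (intro has_bochner_integral_real_indicator) auto
    moreover have "bid_cdf_integral T \<alpha> t x = measure lborel {x<..<T}"
      using assms True by (simp add: bid_cdf_integral_def)
    ultimately show ?thesis
      using True by (subst has_bochner_integral_cong[where g="indicator {x<..<T}", OF refl _ refl])
        (auto simp: bid_cdf_def indicator_def)
  next
    case False
    with assms have t: "t < T" by simp
    \<comment> \<open>The integrand vanishes beyond \<open>t\<close>, and on \<open>[x, t]\<close>
      the term \<open>- (1 - \<alpha>) * (T - t) powr \<alpha> * (T - y) powr (- \<alpha>)\<close>
      is the derivative of \<open>(T - t) powr \<alpha> * (T - y) powr (1 - \<alpha>)\<close>. Since
      \<open>t < T\<close>, there is no singularity.\<close>
    let ?F = "\<lambda>y. y + (T - t) powr \<alpha> * (T - y) powr (1 - \<alpha>)"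
    let ?f = "\<lambda>y. 1 - (1 - \<alpha>) * ((T - t) / (T - y)) powr \<alpha>"
    have "has_bochner_integral lborel (\<lambda>y. ?f y * indicator {x..t} y) (?F t - ?F x)"
    proof (rule has_bochner_integral_FTC_Icc_real)
      fix y assume y: "x \<le> y" "y \<le> t"
      have "(?F has_real_derivative 1 + (T - t) powr \<alpha> * ((1 - \<alpha>) * (T - y) powr (1 - \<alpha> - 1) * (0 - 1))) (at y)"
        using y t by (auto intro!: derivative_eq_intros)
      moreover have "(T - t) powr \<alpha> * (T - y) powr (1 - \<alpha> - 1) = ((T - t) / (T - y)) powr \<alpha>"
        using y t by (simp add: powr_divide powr_minus field_simps)
      ultimately show "(?F has_real_derivative ?f y) (at y)"
        by (simp add: algebra_simps)
      show "isCont ?f y"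
        using y t by (auto intro!: continuous_intros)
    qed (fact x)
    moreover have "?F t - ?F x = bid_cdf_integral T \<alpha> t x"
    proof -
      have "(T - t) powr \<alpha> * (T - t) powr (1 - \<alpha>) = T - t"
        using t by (simp add: powr_add[symmetric])
      moreover have "(T - t) powr \<alpha> * (T - x) powr (1 - \<alpha>) = (T - x) * ((T - t) / (T - x)) powr \<alpha>"
        using t x by (simp add: powr_divide powr_diff)
      ultimately show ?thesis
        using x by (simp add: bid_cdf_integral_def algebra_simps)
    qed
    moreover have "has_bochner_integral lborel (\<lambda>y. ?f y * indicator {x..t} y) v
        \<longleftrightarrow> has_bochner_integral lborel (\<lambda>y. indicator {x<..<T} y * bid_cdf T \<alpha> t y) v" for v
    proof (rule has_bochner_integral_cong_AE)
      show "AE y in lborel. ?f y * indicator {x..t} y = indicator {x<..<T} y * bid_cdf T \<alpha> t y"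
        using AE_lborel_singleton[of x] by eventually_elim (use t x in \<open>auto simp: bid_cdf_def indicator_def\<close>)
    qed measurable
    ultimately show ?thesis by simp
  qed
next
  case False
  then have "(\<lambda>y. indicator {x<..<T} y * bid_cdf T \<alpha> t y) = (\<lambda>_. 0)"
    by (auto simp: bid_cdf_def indicator_def fun_eq_iff)
  then show ?thesis
    using False by (simp add: bid_cdf_integral_def has_bochner_integral_zero)
qed

lemma bid_cdf_integral_nonneg:
  assumes "t \<le> T" "x < T"
  shows "0 \<le> bid_cdf_integral T \<alpha> t x"
  using unif_mean_ennreal(2)[OF measurable_bid_cdf bid_cdf_nonneg[OF assms(1)] assms(2) has_integral_bid_cdf[OF assms]] .

lemma bid_cdf_fixed_point:
  assumes "t \<le> T" "x < T"
  shows "bid_cdf T \<alpha> t x = \<alpha> * (if x \<le> t then 1 else 0) + (1 - \<alpha>) * bid_cdf_integral T \<alpha> t x / (T - x)"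
proof -
  have "(1 - \<alpha>) * bid_cdf_integral T \<alpha> t x / (T - x)
      = (if x \<le> t then (1 - \<alpha>) * (1 - ((T - t) / (T - x)) powr \<alpha>) else 0)"
    using assms by (simp add: bid_cdf_integral_def)
  then show ?thesis
    by (simp add: bid_cdf_def algebra_simps)
qed

lemma bid_cdf_fixed_point_ennreal:
  assumes "t \<le> T" "x < T"
  shows "ennreal (bid_cdf T \<alpha> t x) = ennreal \<alpha> * indicator {..t} x
    + ennreal (1 - \<alpha>) * unif_mean T (\<lambda>y. ennreal (bid_cdf T \<alpha> t y)) x"
proof -
  have "unif_mean T (\<lambda>y. ennreal (bid_cdf T \<alpha> t y)) x = ennreal (bid_cdf_integral T \<alpha> t x / (T - x))"
    by (rule unif_mean_ennreal[OF measurable_bid_cdf bid_cdf_nonneg[OF assms(1)] assms(2) has_integral_bid_cdf[OF assms]])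
  moreover have "ennreal (bid_cdf T \<alpha> t x)
      = ennreal (\<alpha> * indicator {..t} x + (1 - \<alpha>) * (bid_cdf_integral T \<alpha> t x / (T - x)))"
    using bid_cdf_fixed_point[OF assms] by (simp add: indicator_def)
  ultimately show ?thesis
    using \<alpha> assms bid_cdf_integral_nonneg[OF assms]
    by (simp add: ennreal_plus ennreal_mult ennreal_indicator del: times_divide_eq_right)
qed

end

section \<open>Weights constant on the cells of a partition, and their solutions\<close>

lemma mono_upto:
  fixes t :: "nat \<Rightarrow> 'a :: order"
  assumes "\<forall>j<n. t j \<le> t (Suc j)" "j \<le> k" "k \<le> n"
  shows "t j \<le> t k"
  using assms(2,3)
proof (induction k rule: dec_induct)
  case (step k)
  then show ?case
    using assms(1) order_trans[of "t j" "t k" "t (Suc k)"] by auto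
qed simp

text \<open>The cells are disjoint when \<open>t\<close> is monotone, so at most one factor differs
  from 1. The product form lets a product over bidders be regrouped into powers of
  \<open>z j\<close> whose exponents count the points in each cell.\<close>

definition cell_weight :: "nat \<Rightarrow> (nat \<Rightarrow> real) \<Rightarrow> (nat \<Rightarrow> real) \<Rightarrow> real \<Rightarrow> real" where
  "cell_weight n t z x = (\<Prod>j<n. if t j < x \<and> x \<le> t (Suc j) then z j else 1)"

lemma measurable_cell_weight [measurable]: "cell_weight n t z \<in> borel_measurable borel"
  unfolding cell_weight_def by measurable

lemma cell_weight_bounds:
  assumes "\<And>j. j < n \<Longrightarrow> 0 \<le> z j \<and> z j \<le> 1"
  shows "0 \<le> cell_weight n t z x" "cell_weight n t z x \<le> 1"
  unfolding cell_weight_def using assms by (auto intro!: prod_nonneg prod_le_1)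

text \<open>The affine form in indicators of half-lines makes linearity available: the bid equation
  is already solved for each such indicator.\<close>

lemma cell_weight_eq:
  assumes "\<forall>j<n. t j \<le> t (Suc j)"
  shows "cell_weight n t z x = 1 - (\<Sum>j<n. (1 - z j) * (indicator {..t (Suc j)} x - indicator {..t j} x))"
  using assms
proof (induction n)
  case 0
  then show ?case by (simp add: cell_weight_def)
next
  case (Suc n)
  note mono = mono_upto[OF Suc.prems]
  have step: "cell_weight (Suc n) t z x = cell_weight n t z x * (if t n < x \<and> x \<le> t (Suc n) then z n else 1)"
    by (simp add: cell_weight_def)
  show ?case
  proof (cases "x \<le> t n")
    case True
    then have "x \<le> t (Suc n)" using mono[of n "Suc n"] by simp
    then show ?thesis
      using True Suc by (simp add: step)
  next
    case False
    have le: "\<not> x \<le> t j" if "j \<le> n" for j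
      using mono[of j n] that False by auto
    then have "cell_weight n t z x = 1"
      unfolding cell_weight_def by (intro prod.neutral) (auto simp: Suc_le_eq)
    moreover have "(\<Sum>j<n. (1 - z j) * (indicator {..t (Suc j)} x - indicator {..t j} x)) = 0"
      using le by (intro sum.neutral) (auto simp: Suc_le_eq)
    ultimately show ?thesis
      using le[of n] by (simp add: step)
  qed
qed

lemma prod_cell_weight:
  assumes "finite I"
  shows "(\<Prod>i\<in>I. cell_weight n t z (x i)) = (\<Prod>j<n. z j ^ card {i\<in>I. t j < x i \<and> x i \<le> t (Suc j)})"
proof -
  have "(\<Prod>i\<in>I. cell_weight n t z (x i)) = (\<Prod>j<n. \<Prod>i\<in>I. if t j < x i \<and> x i \<le> t (Suc j) then z j else 1)"
    unfolding cell_weight_def by (rule prod.swap)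
  also have "\<dots> = (\<Prod>j<n. \<Prod>i\<in>{i\<in>I. t j < x i \<and> x i \<le> t (Suc j)}. z j)"
    by (intro prod.cong refl prod.inter_filter[symmetric] assms)
  finally show ?thesis by simp
qed

lemma card_diff_atMost:
  fixes x :: "nat \<Rightarrow> 'a :: linorder"
  assumes "a \<le> b"
  shows "card {i. i < K \<and> x i \<le> b} - card {i. i < K \<and> x i \<le> a} = card {i. i < K \<and> a < x i \<and> x i \<le> b}"
proof -
  have "{i. i < K \<and> a < x i \<and> x i \<le> b} = {i. i < K \<and> x i \<le> b} - {i. i < K \<and> x i \<le> a}"
    by auto
  moreover have "card ({i. i < K \<and> x i \<le> b} - {i. i < K \<and> x i \<le> a})
      = card {i. i < K \<and> x i \<le> b} - card {i. i < K \<and> x i \<le> a}"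
    using assms by (intro card_Diff_subset) (auto intro: finite_subset[of _ "{..<K}"])
  ultimately show ?thesis by simp
qed

context bid_law
begin

text \<open>The same affine combination as in \<open>cell_weight_eq\<close>, with every half-line
  indicator replaced by its solution \<open>bid_cdf\<close>. The constant 1 stays, because it solves
  the equation for weight 1 below \<open>T\<close>.\<close>

definition cell_mean :: "nat \<Rightarrow> (nat \<Rightarrow> real) \<Rightarrow> (nat \<Rightarrow> real) \<Rightarrow> real \<Rightarrow> real" where
  "cell_mean n t z x = 1 - (\<Sum>j<n. (1 - z j) * (bid_cdf T \<alpha> (t (Suc j)) x - bid_cdf T \<alpha> (t j) x))"

lemma measurable_cell_mean [measurable]: "cell_mean n t z \<in> borel_measurable borel"
  unfolding cell_mean_def by measurable

context
  fixes n :: nat and t z :: "nat \<Rightarrow> real"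
  assumes t: "\<forall>j<n. t j \<le> t (Suc j)" "t n \<le> T"
begin

lemma partition_le: "j \<le> n \<Longrightarrow> t j \<le> T"
  using mono_upto[OF t(1), of j n] t(2) by simp

lemma has_integral_cell_mean:
  assumes "x < T"
  shows "has_bochner_integral lborel (\<lambda>y. indicator {x<..<T} y * (1 - cell_mean n t z y))
    (\<Sum>j<n. (1 - z j) * (bid_cdf_integral T \<alpha> (t (Suc j)) x - bid_cdf_integral T \<alpha> (t j) x))"
proof -
  have "has_bochner_integral lborel
    (\<lambda>y. \<Sum>j<n. (1 - z j) * (indicator {x<..<T} y * bid_cdf T \<alpha> (t (Suc j)) y - indicator {x<..<T} y * bid_cdf T \<alpha> (t j) y))
    (\<Sum>j<n. (1 - z j) * (bid_cdf_integral T \<alpha> (t (Suc j)) x - bid_cdf_integral T \<alpha> (t j) x))"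
    using assms partition_le
    by (intro has_bochner_integral_sum has_bochner_integral_mult_right has_bochner_integral_diff has_integral_bid_cdf) auto
  then show ?thesis
    by (simp add: cell_mean_def sum_distrib_left right_diff_distrib mult.left_commute)
qed

lemma cell_mean_left_continuous:
  assumes "x \<le> T"
  shows "(cell_mean n t z \<longlongrightarrow> cell_mean n t z x) (at_left x)"
  unfolding cell_mean_def using assms partition_le
  by (intro tendsto_intros bid_cdf_left_continuous) auto

context
  assumes z: "\<And>j. j < n \<Longrightarrow> 0 \<le> z j \<and> z j \<le> 1"
begin

text \<open>\<open>bid_cdf\<close> increases with the time bound, so its increments are nonnegative
  and telescope to at most 1; coefficients \<open>1 - z j\<close> in \<open>[0, 1]\<close> keep the
  subtracted sum within these bounds.\<close>

lemma cell_mean_bounds: "0 \<le> cell_mean n t z x" "cell_mean n t z x \<le> 1"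
proof -
  have mono: "bid_cdf T \<alpha> (t j) x \<le> bid_cdf T \<alpha> (t (Suc j)) x" if "j < n" for j
    using that t(1) partition_le[of "Suc j"] by (intro bid_cdf_mono) auto
  have "(\<Sum>j<n. (1 - z j) * (bid_cdf T \<alpha> (t (Suc j)) x - bid_cdf T \<alpha> (t j) x))
      \<le> (\<Sum>j<n. bid_cdf T \<alpha> (t (Suc j)) x - bid_cdf T \<alpha> (t j) x)"
    using mono z by (intro sum_mono mult_left_le_one_le) auto
  also have "\<dots> = bid_cdf T \<alpha> (t n) x - bid_cdf T \<alpha> (t 0) x"
    by (rule sum_lessThan_telescope)
  also have "\<dots> \<le> 1"
    using bid_cdf_nonneg[of "t 0" x] bid_cdf_le_1[of "t n" x] partition_le[of 0] by simp
  finally show "0 \<le> cell_mean n t z x" by (simp add: cell_mean_def)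
  have "0 \<le> (\<Sum>j<n. (1 - z j) * (bid_cdf T \<alpha> (t (Suc j)) x - bid_cdf T \<alpha> (t j) x))"
    using mono z by (intro sum_nonneg mult_nonneg_nonneg) auto
  then show "cell_mean n t z x \<le> 1" by (simp add: cell_mean_def)
qed

lemma cell_mean_fixed_point:
  assumes x: "x < T"
  shows "ennreal (cell_mean n t z x) = ennreal \<alpha> * ennreal (cell_weight n t z x)
    + ennreal (1 - \<alpha>) * unif_mean T (\<lambda>y. ennreal (cell_mean n t z y)) x"
proof -
  let ?I = "\<Sum>j<n. (1 - z j) * (bid_cdf_integral T \<alpha> (t (Suc j)) x - bid_cdf_integral T \<alpha> (t j) x)"
  have "has_bochner_integral lborel (indicator {x<..<T} :: real \<Rightarrow> real) (T - x)"
    using x has_bochner_integral_real_indicator[of "{x<..<T}" lborel] by simp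
  from has_bochner_integral_diff[OF this has_integral_cell_mean[OF x]]
  have int: "has_bochner_integral lborel (\<lambda>y. indicator {x<..<T} y * cell_mean n t z y) (T - x - ?I)"
    by (simp add: right_diff_distrib)
  note nonneg = unif_mean_ennreal(2)[OF _ cell_mean_bounds(1) x int, OF measurable_cell_mean]
  note um = unif_mean_ennreal(1)[OF _ cell_mean_bounds(1) x int, OF measurable_cell_mean]
  have "bid_cdf T \<alpha> (t j) x = \<alpha> * indicator {..t j} x + (1 - \<alpha>) * bid_cdf_integral T \<alpha> (t j) x / (T - x)" if "j \<le> n" for j
    using bid_cdf_fixed_point[OF partition_le[OF that] x] by simp
  then have "cell_mean n t z x = 1 - (\<Sum>j<n. (1 - z j) * (\<alpha> * indicator {..t (Suc j)} x + (1 - \<alpha>) * bid_cdf_integral T \<alpha> (t (Suc j)) x / (T - x)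
      - (\<alpha> * indicator {..t j} x + (1 - \<alpha>) * bid_cdf_integral T \<alpha> (t j) x / (T - x))))"
    unfolding cell_mean_def by (intro arg_cong2[where f="(-)"] refl sum.cong) auto
  also have "\<dots> = 1 - (\<alpha> * (\<Sum>j<n. (1 - z j) * (indicator {..t (Suc j)} x - indicator {..t j} x)) + (1 - \<alpha>) / (T - x) * ?I)"
    unfolding sum_distrib_left sum.distrib[symmetric]
    by (intro arg_cong2[where f="(-)"] refl sum.cong) (simp add: algebra_simps diff_divide_distrib)
  also have "\<dots> = \<alpha> * cell_weight n t z x + (1 - \<alpha>) * ((T - x - ?I) / (T - x))"
  proof -
    have "1 - (\<alpha> * A + (1 - \<alpha>) / (T - x) * I) = \<alpha> * (1 - A) + (1 - \<alpha>) * ((T - x - I) / (T - x))" for A I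
    proof -
      define q where "q = I / (T - x)"
      have e1: "(T - x - I) / (T - x) = 1 - q"
        using x by (simp add: q_def diff_divide_distrib)
      have e2: "(1 - \<alpha>) / (T - x) * I = (1 - \<alpha>) * q"
        by (simp add: q_def)
      show ?thesis unfolding e1 e2 by (simp add: algebra_simps)
    qed
    then show ?thesis unfolding cell_weight_eq[OF t(1)] .
  qed
  finally have "ennreal (cell_mean n t z x) = ennreal (\<alpha> * cell_weight n t z x + (1 - \<alpha>) * ((T - x - ?I) / (T - x)))"
    by simp
  also have "\<dots> = ennreal \<alpha> * ennreal (cell_weight n t z x) + ennreal (1 - \<alpha>) * ennreal ((T - x - ?I) / (T - x))"
    using \<alpha> x nonneg cell_weight_bounds[of n z t x] z
    by (simp add: ennreal_plus ennreal_mult[symmetric])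
  finally show ?thesis
    unfolding um .
qed

end

end

end

section \<open>Generating functions of the arrival process\<close>

lemma nn_integral_poisson_power:
  fixes N :: "'a \<Rightarrow> nat"
  assumes "prob_space M" and N: "N \<in> measurable M (count_space UNIV)"
    and poisson: "\<And>k. measure M {\<omega>\<in>space M. N \<omega> = k} = m ^ k / fact k * exp (- m)"
    and z: "0 \<le> z"
  shows "(\<integral>\<^sup>+ \<omega>. ennreal (z ^ N \<omega>) \<partial>M) = ennreal (exp (- ((1 - z) * m)))"
proof -
  interpret prob_space M by fact
  have "(\<integral>\<^sup>+ \<omega>. ennreal (z ^ N \<omega>) \<partial>M) = (\<Sum>k. \<integral>\<^sup>+ \<omega>. indicator {k} (N \<omega>) * ennreal (z ^ k) \<partial>M)"
    by (rule nn_integral_split_nat[OF N]) simp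
  also have "\<dots> = (\<Sum>k. ennreal ((z * m) ^ k / fact k * exp (- m)))"
  proof (rule suminf_cong)
    fix k
    have S: "{\<omega>\<in>space M. N \<omega> = k} \<in> sets M"
      using N by simp
    have "(\<integral>\<^sup>+ \<omega>. indicator {k} (N \<omega>) * ennreal (z ^ k) \<partial>M) = (\<integral>\<^sup>+ \<omega>. ennreal (z ^ k) * indicator {\<omega>\<in>space M. N \<omega> = k} \<omega> \<partial>M)"
      by (intro nn_integral_cong) (auto simp: indicator_def)
    also have "\<dots> = ennreal (z ^ k) * ennreal (m ^ k / fact k * exp (- m))"
      using S by (simp add: nn_integral_cmult_indicator emeasure_eq_measure poisson)
    also have "\<dots> = ennreal ((z * m) ^ k / fact k * exp (- m))"
      using z by (simp add: ennreal_mult''[symmetric] power_mult_distrib mult.assoc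
          ennreal_mult'[symmetric])
    finally show "(\<integral>\<^sup>+ \<omega>. indicator {k} (N \<omega>) * ennreal (z ^ k) \<partial>M) = ennreal ((z * m) ^ k / fact k * exp (- m))" .
  qed
  also have "(\<Sum>k. ennreal ((z * m) ^ k / fact k * exp (- m))) = ennreal (exp (z * m) * exp (- m))"
  proof (rule suminf_ennreal_eq)
    \<comment> \<open>No sign of \<open>m\<close> is assumed; nonnegativity is read off from the
      fact that the remaining factor is a probability.\<close>
    show "0 \<le> (z * m) ^ k / fact k * exp (- m)" for k
    proof -
      have "0 \<le> m ^ k / fact k * exp (- m)"
        using poisson[of k] by (metis measure_nonneg)
      then have "0 \<le> z ^ k * (m ^ k / fact k * exp (- m))"
        by (rule mult_nonneg_nonneg[OF zero_le_power[OF z]])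
      then show ?thesis by (simp add: power_mult_distrib)
    qed
    show "(\<lambda>k. (z * m) ^ k / fact k * exp (- m)) sums (exp (z * m) * exp (- m))"
      using exp_converges[of "z * m"] by (intro sums_mult2) (simp add: divide_inverse mult.commute)
  qed
  also have "exp (z * m) * exp (- m) = exp (- ((1 - z) * m))"
    by (simp add: exp_add[symmetric] algebra_simps)
  finally show ?thesis .
qed

lemma poisson_process_pgf:
  assumes N: "poisson_process_on M T r N"
    and t: "0 \<le> t 0" "\<forall>j<n. t j \<le> t (Suc j)" "t n \<le> T" and z: "\<And>j. j < n \<Longrightarrow> 0 \<le> z j"
  shows "(\<integral>\<^sup>+ \<omega>. (\<Prod>j<n. ennreal (z j ^ (N (t (Suc j)) \<omega> - N (t j) \<omega>))) \<partial>M)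
    = ennreal (exp (- (\<Sum>j<n. (1 - z j) * (LINT x:{t j<..<t (Suc j)}|lborel. r x))))"
proof -
  interpret prob_space M
    using N by (simp add: poisson_process_on_def)
  have "indep_vars (\<lambda>_. count_space UNIV) (\<lambda>j \<omega>. N (t (Suc j)) \<omega> - N (t j) \<omega>) {..<n}"
    using N t unfolding poisson_process_on_def by blast
  then have "indep_vars (\<lambda>_. borel) (\<lambda>j \<omega>. ennreal (z j ^ (N (t (Suc j)) \<omega> - N (t j) \<omega>))) {..<n}"
    by (rule indep_vars_compose2) simp
  then have "(\<integral>\<^sup>+ \<omega>. (\<Prod>j<n. ennreal (z j ^ (N (t (Suc j)) \<omega> - N (t j) \<omega>))) \<partial>M)
    = (\<Prod>j<n. \<integral>\<^sup>+ \<omega>. ennreal (z j ^ (N (t (Suc j)) \<omega> - N (t j) \<omega>)) \<partial>M)"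
    by (intro indep_vars_nn_integral) auto
  also have "\<dots> = (\<Prod>j<n. ennreal (exp (- ((1 - z j) * (LINT x:{t j<..<t (Suc j)}|lborel. r x)))))"
  proof (intro prod.cong refl nn_integral_poisson_power prob_space_axioms)
    fix j assume "j \<in> {..<n}"
    then have j: "0 \<le> t j" "t j \<le> t (Suc j)" "t (Suc j) \<le> T" "0 \<le> z j"
      using mono_upto[OF t(2), of 0 j] mono_upto[OF t(2), of "Suc j" n] t z by auto
    show "0 \<le> z j" by fact
    have "N (t j) \<in> measurable M (count_space UNIV)" "N (t (Suc j)) \<in> measurable M (count_space UNIV)"
      using N j unfolding poisson_process_on_def by auto
    then show "(\<lambda>\<omega>. N (t (Suc j)) \<omega> - N (t j) \<omega>) \<in> measurable M (count_space UNIV)"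
      by simp
    show "prob {\<omega>\<in>space M. N (t (Suc j)) \<omega> - N (t j) \<omega> = k} =
      (LINT x:{t j<..<t (Suc j)}|lborel. r x) ^ k / fact k * exp (- (LINT x:{t j<..<t (Suc j)}|lborel. r x))" for k
      using N j unfolding poisson_process_on_def by blast
  qed
  also have "\<dots> = ennreal (exp (- (\<Sum>j<n. (1 - z j) * (LINT x:{t j<..<t (Suc j)}|lborel. r x))))"
    by (simp add: prod_ennreal exp_sum[symmetric] sum_negf)
  finally show ?thesis .
qed

lemma cell_weight_value:
  assumes "\<forall>i<n. t i \<le> t (Suc i)" "j < n" "t j < x" "x \<le> t (Suc j)"
  shows "cell_weight n t z x = z j"
proof -
  have "\<not> (t i < x \<and> x \<le> t (Suc i))" if "i < n" "i \<noteq> j" for i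
    using that assms mono_upto[OF assms(1), of "Suc i" j] mono_upto[OF assms(1), of "Suc j" i]
    by (cases "i < j") auto
  then have "cell_weight n t z x = (\<Prod>i<n. if i = j then z j else 1)"
    unfolding cell_weight_def using assms by (intro prod.cong) auto
  then show ?thesis
    using assms by simp
qed

definition grid :: "real \<Rightarrow> nat \<Rightarrow> nat \<Rightarrow> real" where
  "grid T m j = real j * T / real (Suc m)"

lemma grid_mono: "0 < T \<Longrightarrow> grid T m j \<le> grid T m (Suc j)"
  by (simp add: grid_def divide_right_mono)

lemma grid_end: "grid T m (Suc m) = T"
  by (simp add: grid_def del: of_nat_Suc)

text \<open>The step function takes at \<open>x\<close> the value of \<open>g\<close> at the left
  endpoint of the cell containing \<open>x\<close>. These endpoints lie strictly below
  \<open>x\<close> within one mesh width, so left continuity suffices.\<close>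

lemma cell_weight_grid_tendsto:
  assumes x: "0 < x" "x \<le> T" and g: "(g \<longlongrightarrow> g x) (at_left x)"
  shows "(\<lambda>m. cell_weight (Suc m) (grid T m) (\<lambda>j. g (grid T m j)) x) \<longlonglongrightarrow> g x"
proof -
  have T: "0 < T" using x by simp
  have "\<exists>y. x - T / real (Suc m) \<le> y \<and> y < x \<and> cell_weight (Suc m) (grid T m) (\<lambda>j. g (grid T m j)) x = g y" for m
  proof -
    \<comment> \<open>The first cell whose right endpoint reaches \<open>x\<close>; minimality puts
      \<open>x\<close> strictly beyond its left endpoint, which matches the half-open cells.\<close>
    define j where "j = (LEAST j. x \<le> grid T m (Suc j))"
    have ex: "x \<le> grid T m (Suc m)"
      using x by (simp add: grid_end)
    then have j: "x \<le> grid T m (Suc j)" "j \<le> m"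
      unfolding j_def by (rule LeastI, rule Least_le)
    have less: "grid T m j < x"
    proof (cases j)
      case 0
      then show ?thesis using x by (simp add: grid_def)
    next
      case (Suc i)
      then have "\<not> x \<le> grid T m (Suc i)"
        unfolding j_def using not_less_Least[of i "\<lambda>j. x \<le> grid T m (Suc j)"] by simp
      then show ?thesis using Suc by simp
    qed
    have "grid T m (Suc j) = grid T m j + T / real (Suc m)"
      by (simp add: grid_def add_divide_distrib algebra_simps del: of_nat_Suc) (simp add: algebra_simps add_divide_distrib)
    moreover have "cell_weight (Suc m) (grid T m) (\<lambda>j. g (grid T m j)) x = g (grid T m j)"
      using T j less by (intro cell_weight_value) (auto intro: grid_mono)
    ultimately show ?thesis
      using j less by (intro exI[of _ "grid T m j"]) auto
  qed
  then obtain y where y: "\<And>m. x - T / real (Suc m) \<le> y m" "\<And>m. y m < x"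
      "\<And>m. cell_weight (Suc m) (grid T m) (\<lambda>j. g (grid T m j)) x = g (y m)"
    by metis
  have "y \<longlonglongrightarrow> x"
  proof (rule tendsto_sandwich)
    have "(\<lambda>m. x - T / real (Suc m)) \<longlonglongrightarrow> x - 0"
      by (intro tendsto_diff tendsto_const LIMSEQ_Suc[OF lim_const_over_n])
    then show "(\<lambda>m. x - T / real (Suc m)) \<longlonglongrightarrow> x" by simp
    show "(\<lambda>_. x) \<longlonglongrightarrow> x" by simp
  qed (use y in \<open>auto intro!: always_eventually less_imp_le\<close>)
  then have "filterlim y (at_left x) sequentially"
    unfolding filterlim_at using y by (auto intro!: always_eventually simp: less_imp_neq)
  from filterlim_compose[OF g this] show ?thesis
    unfolding y(3) .
qed

lemma has_integral_cell_weight: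
  assumes "0 < T" "0 \<le> t 0" "\<forall>j<n. t j \<le> t (Suc j)" "t n \<le> T"
  shows "has_bochner_integral lborel (\<lambda>y. indicator {0<..<T} y * (1 - cell_weight n t z y))
    (\<Sum>j<n. (1 - z j) * (t (Suc j) - t j))"
proof -
  \<comment> \<open>For \<open>\<alpha> = 1\<close> the bid is placed on arrival, so that \<open>cell_mean\<close> is \<open>cell_weight\<close>.\<close>
  interpret L: bid_law T 1 by standard auto
  have t: "0 \<le> t j" if "j \<le> n" for j
    using mono_upto[OF assms(3), of 0 j] assms(2) that by simp
  have "bid_cdf T 1 t = indicator {..t}" for t
    by (auto simp: bid_cdf_def fun_eq_iff)
  then have "cell_weight n t z y = L.cell_mean n t z y" for y
    by (simp add: cell_weight_eq[OF assms(3)] L.cell_mean_def)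
  moreover have "bid_cdf_integral T 1 (t j) 0 = t j" if "j \<le> n" for j
    using t[OF that] assms mono_upto[OF assms(3), of j n] that
    by (simp add: bid_cdf_integral_def field_simps)
  then have "(\<Sum>j<n. (1 - z j) * (bid_cdf_integral T 1 (t (Suc j)) 0 - bid_cdf_integral T 1 (t j) 0))
    = (\<Sum>j<n. (1 - z j) * (t (Suc j) - t j))"
    by (intro sum.cong) auto
  ultimately show ?thesis
    using L.has_integral_cell_mean[OF assms(3,4,1), where z = z] by simp
qed

section \<open>Poisson variables from their joint generating function\<close>

text \<open>The constant coefficient is the limit of the sum at 0; removing it and dividing by
  \<open>x\<close> shifts the series, so induction reaches every coefficient.\<close>

lemma powser_eq_0:
  fixes c :: "nat \<Rightarrow> real"
  assumes "\<And>x. 0 < x \<Longrightarrow> x < 1 \<Longrightarrow> (\<lambda>k. c k * x ^ k) sums 0"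
  shows "c k = 0"
proof -
  have base: "c 0 = 0" if c: "\<And>x. 0 < x \<Longrightarrow> x < 1 \<Longrightarrow> (\<lambda>k. c k * x ^ k) sums 0" for c :: "nat \<Rightarrow> real"
  proof -
    have "summable (\<lambda>k. c k * (1 / 2) ^ k)"
      using c[of "1/2"] by (auto simp: sums_iff)
    then have "(\<lambda>k. c k * x ^ k) sums (\<Sum>k. c k * x ^ k)" if "norm x < 1 / 2" for x :: real
      using that by (intro summable_sums powser_inside[of c "1/2" x]) auto
    then have "((\<lambda>x. \<Sum>k. c k * x ^ k) \<longlongrightarrow> c 0) (at 0)"
      by (rule powser_limit_0[of "1/2", rotated]) auto
    \<comment> \<open>The sum is known to vanish only for positive arguments, hence the limit is
      compared from the right.\<close>
    then have "((\<lambda>x. \<Sum>k. c k * x ^ k) \<longlongrightarrow> c 0) (at_right 0)"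
      by (rule tendsto_mono[OF at_le, rotated]) simp
    moreover have "\<forall>\<^sub>F x in at_right 0. 0 = (\<Sum>k. c k * x ^ k)"
      using c by (intro eventually_at_rightI[of 0 1]) (auto simp: sums_iff)
    then have "((\<lambda>x. \<Sum>k. c k * x ^ k) \<longlongrightarrow> 0) (at_right 0)"
      by (rule Lim_transform_eventually[rotated]) simp
    ultimately show ?thesis
      by (intro tendsto_unique[of "at_right 0"]) auto
  qed
  show ?thesis
    using assms
  proof (induction k arbitrary: c)
    case (Suc k c)
    have "(\<lambda>k. c (Suc k) * x ^ k) sums 0" if x: "0 < x" "x < 1" for x
    proof -
      have "(\<lambda>k. c (Suc k) * x ^ Suc k) sums 0"
        using Suc.prems[OF x] base[of c, OF Suc.prems] by (subst sums_Suc_iff) simp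
      then have "(\<lambda>k. (1 / x) * (c (Suc k) * x ^ Suc k)) sums ((1 / x) * 0)"
        by (rule sums_mult)
      then show ?thesis
        using x by simp
    qed
    then show ?case
      by (rule Suc.IH)
  qed (rule base)
qed

lemma powser_eq:
  fixes a b :: "nat \<Rightarrow> real"
  assumes "\<And>x. 0 < x \<Longrightarrow> x < 1 \<Longrightarrow> (\<lambda>k. a k * x ^ k) sums f x"
    and "\<And>x. 0 < x \<Longrightarrow> x < 1 \<Longrightarrow> (\<lambda>k. b k * x ^ k) sums f x"
  shows "a k = b k"
proof -
  have "a k - b k = 0"
  proof (rule powser_eq_0[of "\<lambda>k. a k - b k"])
    fix x :: real assume "0 < x" "x < 1"
    from sums_diff[OF assms[OF this]] show "(\<lambda>k. (a k - b k) * x ^ k) sums 0"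
      by (simp add: left_diff_distrib)
  qed
  then show ?thesis by simp
qed

text \<open>Here \<open>Y\<close> stands for the factors of all other variables and \<open>C\<close>
  for their expected contribution. Splitting over the values of \<open>N\<close> makes the left-hand
  side a power series in \<open>x\<close>, to be compared with the exponential series.\<close>

lemma (in prob_space) poisson_factor_from_pgf:
  fixes N :: "'a \<Rightarrow> nat" and Y :: "'a \<Rightarrow> real"
  assumes [measurable]: "N \<in> measurable M (count_space UNIV)" "Y \<in> borel_measurable M"
    and Y: "\<And>\<omega>. 0 \<le> Y \<omega>"
    and m: "0 \<le> m" "0 \<le> C"
    and pgf: "\<And>x. 0 < x \<Longrightarrow> x < 1 \<Longrightarrow>
      (\<integral>\<^sup>+ \<omega>. ennreal (Y \<omega> * x ^ N \<omega>) \<partial>M) = ennreal (C * exp (- ((1 - x) * m)))"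
  shows "(\<integral>\<^sup>+ \<omega>. ennreal (Y \<omega> * indicator {k} (N \<omega>)) \<partial>M) = ennreal (C * (m ^ k / fact k * exp (- m)))"
proof -
  let ?A = "\<lambda>k. \<integral>\<^sup>+ \<omega>. ennreal (Y \<omega> * indicator {k} (N \<omega>)) \<partial>M"
  have [measurable]: "(\<lambda>\<omega>. indicator {k} (N \<omega>) :: real) \<in> borel_measurable M" for k
    by (rule measurable_compose[OF assms(1)]) simp
  have [measurable]: "(\<lambda>\<omega>. x ^ N \<omega>) \<in> borel_measurable M" for x :: real
    by (rule measurable_compose[OF assms(1)]) simp
  have series: "(\<Sum>k. ?A k * ennreal (x ^ k)) = ennreal (C * exp (- ((1 - x) * m)))"
    if x: "0 < x" "x < 1" for x
  proof -
    have "(\<integral>\<^sup>+ \<omega>. ennreal (Y \<omega> * x ^ N \<omega>) \<partial>M)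
        = (\<Sum>k. \<integral>\<^sup>+ \<omega>. indicator {k} (N \<omega>) * ennreal (Y \<omega> * x ^ k) \<partial>M)"
      by (rule nn_integral_split_nat[OF assms(1)]) simp
    also have "\<dots> = (\<Sum>k. ?A k * ennreal (x ^ k))"
    proof (rule suminf_cong)
      fix k
      have "(\<integral>\<^sup>+ \<omega>. indicator {k} (N \<omega>) * ennreal (Y \<omega> * x ^ k) \<partial>M)
        = (\<integral>\<^sup>+ \<omega>. ennreal (Y \<omega> * indicator {k} (N \<omega>)) * ennreal (x ^ k) \<partial>M)"
        using x Y by (intro nn_integral_cong) (auto simp: indicator_def ennreal_mult)
      then show "(\<integral>\<^sup>+ \<omega>. indicator {k} (N \<omega>) * ennreal (Y \<omega> * x ^ k) \<partial>M) = ?A k * ennreal (x ^ k)"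
        by (simp add: nn_integral_multc)
    qed
    finally show ?thesis using pgf[OF x] by simp
  qed
  \<comment> \<open>An infinite coefficient would make the series infinite at
    \<open>x = 1/2\<close>, contradicting the finite right-hand side. Only then may the coefficients
    be compared as reals.\<close>
  have fin: "?A k \<noteq> top" for k
  proof
    assume "?A k = top"
    then have "?A k * ennreal ((1 / 2) ^ k) = top"
      by (simp add: ennreal_top_mult ennreal_zero_less_divide)
    moreover have "?A k * ennreal ((1 / 2) ^ k) \<le> (\<Sum>k. ?A k * ennreal ((1 / 2) ^ k))"
      using sum_le_suminf[of "\<lambda>k. ?A k * ennreal ((1 / 2) ^ k)" "{k}"] by simp
    ultimately show False
      using series[of "1/2"] by (auto simp: top_unique)
  qed
  define a where "a k = enn2real (?A k)" for k
  have A: "?A k = ennreal (a k)" for k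
    unfolding a_def using fin[of k] by (simp add: less_top)
  have a0: "0 \<le> a k" for k by (simp add: a_def)
  have "a k = C * (m ^ k / fact k * exp (- m))"
  proof (rule powser_eq[where f="\<lambda>x. C * exp (- ((1 - x) * m))"])
    fix x :: real assume x: "0 < x" "x < 1"
    let ?f = "\<lambda>k. a k * x ^ k"
    have s: "(\<Sum>k. ennreal (?f k)) = ennreal (C * exp (- ((1 - x) * m)))"
      using series[OF x] x a0 by (simp add: A ennreal_mult)
    then have sm: "summable ?f"
      using x a0 by (intro summable_suminf_not_top) auto
    have f0: "0 \<le> ?f k" for k using x a0 by simp
    have "suminf ?f = C * exp (- ((1 - x) * m))"
      using s suminf_nonneg[OF sm f0] m unfolding suminf_ennreal2[OF f0 sm] by simp
    with sm show "?f sums (C * exp (- ((1 - x) * m)))"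
      by (simp add: sums_iff)
    have e: "C * exp (- m) * exp (x * m) = C * exp (- ((1 - x) * m))"
      by (simp add: mult.assoc exp_add[symmetric] algebra_simps)
    have "(\<lambda>k. C * exp (- m) * ((x * m) ^ k /\<^sub>R fact k)) sums (C * exp (- ((1 - x) * m)))"
      unfolding e[symmetric] by (intro sums_mult exp_converges)
    then show "(\<lambda>k. C * (m ^ k / fact k * exp (- m)) * x ^ k) sums (C * exp (- ((1 - x) * m)))"
      by (simp add: power_mult_distrib divide_inverse mult_ac)
  qed
  then show ?thesis
    using A by simp
qed

context prob_space
begin

context
  fixes n :: nat and X :: "nat \<Rightarrow> 'a \<Rightarrow> nat" and m :: "nat \<Rightarrow> real"
  assumes X: "\<And>j. j < n \<Longrightarrow> X j \<in> measurable M (count_space UNIV)"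
    and m: "\<And>j. j < n \<Longrightarrow> 0 \<le> m j"
    and pgf: "\<And>z. (\<And>j. j < n \<Longrightarrow> 0 \<le> z j \<and> z j \<le> 1) \<Longrightarrow>
      (\<integral>\<^sup>+ \<omega>. ennreal (\<Prod>j<n. z j ^ X j \<omega>) \<partial>M) = ennreal (\<Prod>j<n. exp (- ((1 - z j) * m j)))"
begin

text \<open>\<open>L\<close> collects the variables whose generating factor has already been
  replaced by the event of taking the value \<open>k j\<close>. Adding \<open>l\<close> lets the
  argument \<open>z l\<close> vary over \<open>(0, 1)\<close>, so the induction hypothesis is needed
  for \<open>z(l := x)\<close> and \<open>z\<close> is kept arbitrary.\<close>

lemma pgf_mixed:
  assumes "finite L" "L \<subseteq> {..<n}" and z: "\<And>j. j < n \<Longrightarrow> 0 \<le> z j \<and> z j \<le> 1"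
  shows "(\<integral>\<^sup>+ \<omega>. ennreal (\<Prod>j<n. if j \<in> L then indicator {k j} (X j \<omega>) else z j ^ X j \<omega>) \<partial>M)
    = ennreal (\<Prod>j<n. if j \<in> L then m j ^ k j / fact (k j) * exp (- m j) else exp (- ((1 - z j) * m j)))"
  using assms
proof (induction L arbitrary: z rule: finite_induct)
  case empty
  then show ?case using pgf by simp
next
  case (insert l L)
  let ?u = "\<lambda>z L j \<omega>. if j \<in> L then indicator {k j} (X j \<omega>) else z j ^ X j \<omega> :: real"
  let ?v = "\<lambda>z L j. if j \<in> L then m j ^ k j / fact (k j) * exp (- m j) else exp (- ((1 - z j) * m j)) :: real"
  have l: "l < n" using insert by auto
  have r: "(\<Prod>j<n. v j) = (\<Prod>j\<in>{..<n}-{l}. v j) * v l" for v :: "nat \<Rightarrow> real"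
    using l by (subst prod.remove[of _ l]) (auto simp: mult.commute)
  let ?Y = "\<lambda>\<omega>. \<Prod>j\<in>{..<n}-{l}. ?u z L j \<omega>" and ?C = "\<Prod>j\<in>{..<n}-{l}. ?v z L j"
  have "(\<integral>\<^sup>+ \<omega>. ennreal (?Y \<omega> * indicator {k l} (X l \<omega>)) \<partial>M)
      = ennreal (?C * (m l ^ k l / fact (k l) * exp (- m l)))"
  proof (rule poisson_factor_from_pgf)
    show "X l \<in> measurable M (count_space UNIV)" using X l .
    show "?Y \<in> borel_measurable M"
    proof (rule borel_measurable_prod)
      fix j assume "j \<in> {..<n} - {l}"
      then have "X j \<in> measurable M (count_space UNIV)" using X by auto
      from measurable_compose[OF this, of "\<lambda>i. if j \<in> L then indicator {k j} i else z j ^ i" borel]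
      show "?u z L j \<in> borel_measurable M" by simp
    qed
    show "0 \<le> ?Y \<omega>" for \<omega>
      using insert.prems by (intro prod_nonneg) auto
    show "0 \<le> m l" using m l .
    show "0 \<le> ?C" using m by (intro prod_nonneg) auto
    fix x :: real assume x: "0 < x" "x < 1"
    have "(\<integral>\<^sup>+ \<omega>. ennreal (\<Prod>j<n. ?u (z(l := x)) L j \<omega>) \<partial>M) = ennreal (\<Prod>j<n. ?v (z(l := x)) L j)"
      using insert.prems x by (intro insert.IH) auto
    moreover have "(\<Prod>j<n. ?u (z(l := x)) L j \<omega>) = ?Y \<omega> * x ^ X l \<omega>" for \<omega>
      unfolding r using insert.hyps by (intro arg_cong2[where f="(*)"] prod.cong) auto
    moreover have "(\<Prod>j<n. ?v (z(l := x)) L j) = ?C * exp (- ((1 - x) * m l))"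
      unfolding r using insert.hyps by (intro arg_cong2[where f="(*)"] prod.cong) auto
    ultimately show "(\<integral>\<^sup>+ \<omega>. ennreal (?Y \<omega> * x ^ X l \<omega>) \<partial>M) = ennreal (?C * exp (- ((1 - x) * m l)))"
      by simp
  qed
  moreover have "(\<Prod>j<n. ?u z (insert l L) j \<omega>) = ?Y \<omega> * indicator {k l} (X l \<omega>)" for \<omega>
    unfolding r by (intro arg_cong2[where f="(*)"] prod.cong) auto
  moreover have "(\<Prod>j<n. ?v z (insert l L) j) = ?C * (m l ^ k l / fact (k l) * exp (- m l))"
    unfolding r by (intro arg_cong2[where f="(*)"] prod.cong) auto
  ultimately show ?case by simp
qed

lemma prob_from_pgf:
  assumes "L \<subseteq> {..<n}"
  shows "prob {\<omega>\<in>space M. \<forall>j\<in>L. X j \<omega> = k j} = (\<Prod>j\<in>L. m j ^ k j / fact (k j) * exp (- m j))"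
proof -
  have fin: "finite L" using assms finite_subset by blast
  have S: "{\<omega>\<in>space M. \<forall>j\<in>L. X j \<omega> = k j} \<in> sets M"
  proof -
    have "Measurable.pred M (\<lambda>\<omega>. X j \<omega> = k j)" if "j \<in> L" for j
      using X[of j] that assms by (auto simp: subset_iff)
    then show ?thesis
      using fin by (intro sets.sets_Collect_finite_All) (auto simp: pred_def)
  qed
  \<comment> \<open>Taking \<open>z = 1\<close> turns the factors outside \<open>L\<close> into 1 on
    both sides, which leaves the marginal law of the variables in \<open>L\<close>.\<close>
  have "(\<integral>\<^sup>+ \<omega>. ennreal (\<Prod>j<n. if j \<in> L then indicator {k j} (X j \<omega>) else 1 ^ X j \<omega>) \<partial>M)
    = ennreal (\<Prod>j<n. if j \<in> L then m j ^ k j / fact (k j) * exp (- m j) else exp (- ((1 - 1) * m j)))"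
    by (rule pgf_mixed[OF fin assms]) simp
  also have "(\<lambda>\<omega>. ennreal (\<Prod>j<n. if j \<in> L then indicator {k j} (X j \<omega>) else 1 ^ X j \<omega>))
      = (\<lambda>\<omega>. indicator {\<omega>. \<forall>j\<in>L. X j \<omega> = k j} \<omega>)"
  proof
    fix \<omega>
    have "(\<Prod>j<n. if j \<in> L then indicator {k j} (X j \<omega>) else 1 ^ X j \<omega> :: real) = (\<Prod>j\<in>L. indicator {k j} (X j \<omega>))"
      using assms by (simp add: prod.If_cases Int_absorb1)
    also have "\<dots> = indicator {\<omega>. \<forall>j\<in>L. X j \<omega> = k j} \<omega>"
      using fin by (auto simp: indicator_def)
    finally show "ennreal (\<Prod>j<n. if j \<in> L then indicator {k j} (X j \<omega>) else 1 ^ X j \<omega>)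
      = indicator {\<omega>. \<forall>j\<in>L. X j \<omega> = k j} \<omega>"
      by (simp add: ennreal_indicator)
  qed
  also have "(\<integral>\<^sup>+ \<omega>. indicator {\<omega>. \<forall>j\<in>L. X j \<omega> = k j} \<omega> \<partial>M) = (\<integral>\<^sup>+ \<omega>. indicator {\<omega>\<in>space M. \<forall>j\<in>L. X j \<omega> = k j} \<omega> \<partial>M)"
    by (intro nn_integral_cong) (simp add: indicator_def)
  also have "\<dots> = ennreal (prob {\<omega>\<in>space M. \<forall>j\<in>L. X j \<omega> = k j})"
    using S by (simp add: emeasure_eq_measure)
  also have "(\<Prod>j<n. if j \<in> L then m j ^ k j / fact (k j) * exp (- m j) else exp (- ((1 - 1) * m j)))
      = (\<Prod>j\<in>L. m j ^ k j / fact (k j) * exp (- m j))"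
    using assms by (simp add: prod.If_cases Int_absorb1)
  finally show ?thesis
    using m assms by (subst (asm) ennreal_inj) (auto intro!: prod_nonneg simp: subset_iff)
qed

lemma indep_vars_from_pgf: "indep_vars (\<lambda>_. count_space UNIV) X {..<n}"
proof (cases "n = 0")
  case True
  then show ?thesis
    by (simp add: indep_vars_def indep_sets_def)
next
  case False
  \<comment> \<open>Singletons alone are not closed under intersection, hence \<open>{}\<close>.
    \<open>UNIV\<close> supplies the whole space in the generator and covers unconstrained
    coordinates.\<close>
  let ?E = "insert {} (insert UNIV (range (\<lambda>k. {k}))) :: nat set set"
  have gen: "sets (count_space UNIV) = sigma_sets (space (count_space UNIV)) ?E"
  proof -
    have "A \<in> sigma_sets UNIV ?E" for A
    proof -
      have "\<Union>((\<lambda>k. {k}) ` A) \<in> sigma_sets UNIV ?E"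
        by (rule sigma_sets_UNION) auto
      then show ?thesis by simp
    qed
    then show ?thesis by auto
  qed
  have "prob (\<Inter>j\<in>{..<n}. X j -` A j \<inter> space M) = (\<Prod>j\<in>{..<n}. prob (X j -` A j \<inter> space M))"
    if A: "A \<in> (\<Pi> j\<in>{..<n}. ?E)" for A
  proof (cases "\<exists>j<n. A j = {}")
    case True
    then obtain i where i: "i < n" "A i = {}" by auto
    then have "(\<Inter>j\<in>{..<n}. X j -` A j \<inter> space M) = {}" by blast
    moreover have "(\<Prod>j\<in>{..<n}. prob (X j -` A j \<inter> space M)) = 0"
      using i by (intro prod_zero) (auto intro!: bexI[of _ i])
    ultimately show ?thesis by simp
  next
    case False
    \<comment> \<open>The coordinates with a genuine constraint; each of them has a singleton as its
      set, so the joint event is one of those in \<open>prob_from_pgf\<close>.\<close>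
    define L where "L = {j\<in>{..<n}. A j \<noteq> UNIV}"
    have "\<exists>k. A j = {k}" if "j \<in> L" for j
      using A False that by (auto simp: L_def Pi_iff)
    then obtain k where k: "\<And>j. j \<in> L \<Longrightarrow> A j = {k j}" by metis
    have L: "L \<subseteq> {..<n}" "\<And>j. j < n \<Longrightarrow> j \<notin> L \<Longrightarrow> A j = UNIV" by (auto simp: L_def)
    have "(\<Inter>j\<in>{..<n}. X j -` A j \<inter> space M) = {\<omega>\<in>space M. \<forall>j\<in>L. X j \<omega> = k j}"
    proof -
      have "X j \<omega> \<in> A j \<longleftrightarrow> (j \<in> L \<longrightarrow> X j \<omega> = k j)" if "j < n" for j \<omega>
        using k L that by (cases "j \<in> L") auto
      then show ?thesis
        using L \<open>n \<noteq> 0\<close> by (auto simp: subset_iff)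
    qed
    moreover have "prob (X j -` A j \<inter> space M) = (if j \<in> L then m j ^ k j / fact (k j) * exp (- m j) else 1)" if "j < n" for j
    proof (cases "j \<in> L")
      case True
      then have "X j -` A j \<inter> space M = {\<omega>\<in>space M. \<forall>j\<in>{j}. X j \<omega> = k j}"
        using k by auto
      then show ?thesis
        using prob_from_pgf[of "{j}" k] True that by simp
    next
      case False
      then show ?thesis using L that by (simp add: prob_space)
    qed
    ultimately show ?thesis
      using prob_from_pgf[OF L(1), of k] L(1) by (simp add: prod.If_cases Int_absorb1)
  qed
  moreover have "Int_stable ?E"
    by (auto simp: Int_stable_def)
  ultimately show ?thesis
    using X gen False by (subst indep_vars_finite[where E="\<lambda>_. ?E"]) auto
qed

end

end

section \<open>The bid process\<close>

text \<open>For \<open>\<alpha> < 1\<close> and \<open>0 < c\<close> the intensity blows up at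
  \<open>T\<close>. The fundamental theorem for nonnegative integrands on an open interval needs
  only one-sided limits of the antiderivative and yields integrability along with the value.\<close>

lemma LINT_bid_intensity:
  fixes T \<alpha> c :: real
  assumes "0 < T" "0 < \<alpha>" "0 \<le> c" "0 \<le> u" "u \<le> v" "v \<le> T"
  shows "set_integrable lborel {u<..<v} (\<lambda>x. c * (1 - x / T) powr (\<alpha> - 1))"
    and "(LINT x:{u<..<v}|lborel. c * (1 - x / T) powr (\<alpha> - 1))
      = c * T / \<alpha> * ((1 - u / T) powr \<alpha> - (1 - v / T) powr \<alpha>)"
proof -
  let ?f = "\<lambda>x. c * (1 - x / T) powr (\<alpha> - 1)" and ?F = "\<lambda>x. - (c * T / \<alpha>) * (1 - x / T) powr \<alpha>"
  have "set_integrable lborel {u<..<v} ?f \<and>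
    (LINT x:{u<..<v}|lborel. ?f x) = c * T / \<alpha> * ((1 - u / T) powr \<alpha> - (1 - v / T) powr \<alpha>)"
  proof (cases "u = v")
    case True
    then show ?thesis by (simp add: set_integrable_def set_lebesgue_integral_def)
  next
    case False
    then have uv: "ereal u < ereal v" using assms by simp
    have pos: "0 < 1 - x / T" if "x < v" for x
      using that assms by simp
    \<comment> \<open>At \<open>y = T\<close> the base of the power tends to 0. Convergence still
      holds because the exponent \<alpha> is positive and the base stays nonnegative on
      \<open>{..T}\<close>.\<close>
    have lim: "(?F \<longlongrightarrow> ?F y) (at y within A)" if "y \<le> T" "A \<subseteq> {..T}" for y A
      using that assms
      by (intro tendsto_intros tendsto_powr') (auto simp: eventually_at_filter field_simps intro!: always_eventually)
    have lu: "((?F \<circ> real_of_ereal) \<longlongrightarrow> ?F u) (at_right (ereal u))"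
      unfolding ereal_tendsto_simps using assms False
      by (intro tendsto_intros) auto
    have lv: "((?F \<circ> real_of_ereal) \<longlongrightarrow> ?F v) (at_left (ereal v))"
      unfolding ereal_tendsto_simps using assms by (intro lim) auto
    have der: "(?F has_real_derivative ?f x) (at x)" if "ereal u < ereal x" "ereal x < ereal v" for x
      using that assms pos[of x] by (auto intro!: derivative_eq_intros simp: field_simps)
    have cont: "isCont ?f x" if "ereal u < ereal x" "ereal x < ereal v" for x
      using that pos[of x] assms by (auto intro!: continuous_intros)
    have nonneg: "AE x in lborel. ereal u < ereal x \<longrightarrow> ereal x < ereal v \<longrightarrow> 0 \<le> ?f x"
      using assms by auto
    note FTC = interval_integral_FTC_nonneg[OF uv der cont nonneg lu lv]
    show ?thesis
      using FTC assms False by (simp add: interval_lebesgue_integral_def einterval_eq algebra_simps)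
  qed
  then show "set_integrable lborel {u<..<v} ?f"
    "(LINT x:{u<..<v}|lborel. ?f x) = c * T / \<alpha> * ((1 - u / T) powr \<alpha> - (1 - v / T) powr \<alpha>)"
    by auto
qed

lemma set_integrable_bid_intensity:
  fixes T \<alpha> c :: real
  assumes "0 < T" "0 < \<alpha>" "0 \<le> c"
  shows "set_integrable lborel {0..<T} (\<lambda>x. c * (1 - x / T) powr (\<alpha> - 1))"
proof -
  have ae: "AE x in lborel. indicator {0<..<T} x *\<^sub>R (c * (1 - x / T) powr (\<alpha> - 1))
      = indicator {0..<T} x *\<^sub>R (c * (1 - x / T) powr (\<alpha> - 1))"
    using AE_lborel_singleton[of 0] by eventually_elim (auto simp: indicator_def)
  have "integrable lborel (\<lambda>x. indicator {0<..<T} x *\<^sub>R (c * (1 - x / T) powr (\<alpha> - 1)))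
      \<longleftrightarrow> integrable lborel (\<lambda>x. indicator {0..<T} x *\<^sub>R (c * (1 - x / T) powr (\<alpha> - 1)))"
    by (rule integrable_cong_AE[OF _ _ ae]) auto
  then show ?thesis
    using LINT_bid_intensity(1)[OF assms order.refl less_imp_le[OF assms(1)] order.refl]
    unfolding set_integrable_def by blast
qed

text \<open>Quantifying over the index of the first positive decision, instead of using
  \<open>LEAST\<close> and a case distinction, gives a countable combination of measurable
  conditions.\<close>

lemma bid_time_le_iff:
  "bid_time s d \<le> ereal t \<longleftrightarrow> (\<exists>k. d k \<and> (\<forall>l<k. \<not> d l) \<and> s k \<le> t)"
proof (cases "\<exists>k. d k")
  case True
  have "d k \<and> (\<forall>l<k. \<not> d l) \<longleftrightarrow> k = (LEAST k. d k)" for k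
    using LeastI_ex[OF True] not_less_Least[of _ d] Least_le[of d k] by (metis le_neq_trans)
  then have "(\<exists>k. (d k \<and> (\<forall>l<k. \<not> d l)) \<and> s k \<le> t) \<longleftrightarrow> s (LEAST k. d k) \<le> t"
    by (simp only: simp_thms)
  then show ?thesis
    using True by (simp add: bid_time_def)
qed (auto simp: bid_time_def)

lemma bid_time_eq: "\<exists>k. d k \<Longrightarrow> bid_time s d = ereal (s (LEAST k. d k))"
  by (simp add: bid_time_def)

lemma finite_less_Collect: "finite {i. i < (K :: nat) \<and> P i}"
  by (rule finite_subset[of _ "{..<K}"]) auto

section \<open>Counting the bids of the population\<close>

context bidder_population
begin

lemma measurable_prod_number:
  assumes [measurable]: "\<And>i. v i \<in> borel_measurable M"
  shows "(\<lambda>\<omega>. \<Prod>i<K \<omega>. v i \<omega> :: ennreal) \<in> borel_measurable M"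
  by (rule measurable_compose_countable[where f="\<lambda>n \<omega>. \<Prod>i<n. v i \<omega>", OF _ number_measurable]) measurable

lemma measurable_bid_count: "bid_count K S D t \<in> measurable M (count_space UNIV)"
proof -
  note [measurable] = time_measurable number_measurable measurable_decision
  show ?thesis
    unfolding bid_count_def bid_time_le_iff by measurable
qed

lemma AE_bid_time: "0 < \<alpha> \<Longrightarrow> \<alpha> \<le> 1 \<Longrightarrow>
  AE \<omega> in M. \<forall>i. bid_time (\<lambda>k. S i k \<omega>) (\<lambda>k. D i k \<omega>) = ereal (S i (first_bid i \<omega>) \<omega>)"
  unfolding AE_all_countable
proof
  fix i assume \<alpha>: "0 < \<alpha>" "\<alpha> \<le> 1"
  show "AE \<omega> in M. bid_time (\<lambda>k. S i k \<omega>) (\<lambda>k. D i k \<omega>) = ereal (S i (first_bid i \<omega>) \<omega>)"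
    using AE_ex_success[OF indep_decisions_row decision_prob \<alpha>]
    by eventually_elim (simp add: bid_time_def first_bid_def)
qed

context
  fixes rate :: real
  assumes T: "0 < T" and arrivals: "poisson_process_on M T (\<lambda>_. rate) (arrival_count K S)"
begin

lemma AE_arrival_pos: "AE \<omega> in M. \<forall>i<K \<omega>. 0 < S i 0 \<omega> \<and> S i 0 \<omega> < T"
proof -
  have "AE \<omega> in M. arrival_count K S 0 \<omega> = 0"
    using arrivals by (simp add: poisson_process_on_def)
  then show ?thesis
    using AE_arrival_less
    by eventually_elim (auto simp: arrival_count_def finite_less_Collect not_le)
qed

text \<open>Regrouping the bidders by the cell of their arrival turns the product into powers of the
  \<open>z j\<close> with the increments of the arrival count as exponents, a quantity in which the
  labels have disappeared.\<close>

lemma nn_integral_prod_arrivals_cell: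
  assumes t: "0 \<le> t 0" "\<forall>j<n. t j \<le> t (Suc j)" "t n \<le> T" and z: "\<And>j. j < n \<Longrightarrow> 0 \<le> z j"
  shows "(\<integral>\<^sup>+ \<omega>. (\<Prod>i<K \<omega>. ennreal (cell_weight n t z (S i 0 \<omega>))) \<partial>M)
    = ennreal (exp (- (rate * (\<Sum>j<n. (1 - z j) * (t (Suc j) - t j)))))"
proof -
  have nn: "0 \<le> cell_weight n t z x" for x
    unfolding cell_weight_def using z by (intro prod_nonneg) auto
  have "(\<Prod>i<K \<omega>. ennreal (cell_weight n t z (S i 0 \<omega>)))
    = (\<Prod>j<n. ennreal (z j ^ (arrival_count K S (t (Suc j)) \<omega> - arrival_count K S (t j) \<omega>)))" for \<omega>
  proof -
    have "(\<Prod>i<K \<omega>. ennreal (cell_weight n t z (S i 0 \<omega>)))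
      = ennreal (\<Prod>j<n. z j ^ card {i\<in>{..<K \<omega>}. t j < S i 0 \<omega> \<and> S i 0 \<omega> \<le> t (Suc j)})"
      by (simp add: prod_ennreal nn prod_cell_weight)
    also have "\<dots> = ennreal (\<Prod>j<n. z j ^ (arrival_count K S (t (Suc j)) \<omega> - arrival_count K S (t j) \<omega>))"
      using t unfolding arrival_count_def
      by (intro arg_cong[where f=ennreal] prod.cong refl) (simp add: card_diff_atMost)
    also have "\<dots> = (\<Prod>j<n. ennreal (z j ^ (arrival_count K S (t (Suc j)) \<omega> - arrival_count K S (t j) \<omega>)))"
      using z by (intro prod_ennreal[symmetric]) auto
    finally show ?thesis .
  qed
  then have "(\<integral>\<^sup>+ \<omega>. (\<Prod>i<K \<omega>. ennreal (cell_weight n t z (S i 0 \<omega>))) \<partial>M)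
    = ennreal (exp (- (\<Sum>j<n. (1 - z j) * (LINT x:{t j<..<t (Suc j)}|lborel. rate))))"
    using poisson_process_pgf[OF arrivals t z] by simp
  also have "(\<Sum>j<n. (1 - z j) * (LINT x:{t j<..<t (Suc j)}|lborel. rate)) = rate * (\<Sum>j<n. (1 - z j) * (t (Suc j) - t j))"
    using t by (auto simp: set_lebesgue_integral_def sum_distrib_left intro!: sum.cong)
  finally show ?thesis .
qed

lemma nn_integral_prod_arrivals:
  assumes [measurable]: "g \<in> borel_measurable borel" and g: "\<And>x. 0 \<le> g x" "\<And>x. g x \<le> 1"
    and left: "\<And>x. 0 < x \<Longrightarrow> x < T \<Longrightarrow> (g \<longlongrightarrow> g x) (at_left x)"
  shows "(\<integral>\<^sup>+ \<omega>. (\<Prod>i<K \<omega>. ennreal (g (S i 0 \<omega>))) \<partial>M)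
    = ennreal (exp (- (rate * (\<integral>x. indicator {0<..<T} x * (1 - g x) \<partial>lborel))))"
proof -
  note [measurable] = time_measurable number_measurable
  \<comment> \<open>Sampling \<open>g\<close> at left endpoints of a grid of mesh
    \<open>T / (m + 1)\<close>. Both sides pass to the limit by domination: on the line by the
    indicator of \<open>(0, T)\<close>, on the probability space by 1, since every factor is at most
    1.\<close>
  let ?z = "\<lambda>m j. g (grid T m j)"
  let ?W = "\<lambda>m. cell_weight (Suc m) (grid T m) (?z m)"
  let ?I = "\<lambda>m. \<integral>x. indicator {0<..<T} x * (1 - ?W m x) \<partial>lborel"
  have grid: "0 \<le> grid T m 0" "\<forall>j<Suc m. grid T m j \<le> grid T m (Suc j)" "grid T m (Suc m) \<le> T" for m
    using T by (auto simp: grid_mono grid_end) (simp add: grid_def)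
  have W: "0 \<le> ?W m x" "?W m x \<le> 1" for m x
    using g by (auto intro!: cell_weight_bounds)
  have conv: "(\<lambda>m. ?W m x) \<longlonglongrightarrow> g x" if "0 < x" "x < T" for x
    using that left by (intro cell_weight_grid_tendsto) auto
  have eq: "(\<integral>\<^sup>+ \<omega>. (\<Prod>i<K \<omega>. ennreal (?W m (S i 0 \<omega>))) \<partial>M) = ennreal (exp (- (rate * ?I m)))" for m
    using has_integral_cell_weight[OF T grid, of m "?z m"] g
    by (subst nn_integral_prod_arrivals_cell[OF grid]) (auto simp: has_bochner_integral_iff)
  have "?I \<longlonglongrightarrow> (\<integral>x. indicator {0<..<T} x * (1 - g x) \<partial>lborel)"
  proof (rule integral_dominated_convergence[where w="indicator {0<..<T}"])
    show "integrable lborel (indicator {0<..<T} :: real \<Rightarrow> real)"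
      using T by (intro integrable_real_indicator) auto
    show "AE x in lborel. (\<lambda>m. indicator {0<..<T} x * (1 - ?W m x)) \<longlonglongrightarrow> indicator {0<..<T} x * (1 - g x)"
    proof (rule AE_I2)
      fix x show "(\<lambda>m. indicator {0<..<T} x * (1 - ?W m x)) \<longlonglongrightarrow> indicator {0<..<T} x * (1 - g x)"
        by (cases "x \<in> {0<..<T}") (auto intro!: tendsto_intros conv)
    qed
    show "AE x in lborel. norm (indicator {0<..<T} x * (1 - ?W m x)) \<le> indicator {0<..<T} x" for m
      using W[of m] by (intro AE_I2) (auto simp: indicator_def)
  qed auto
  then have "(\<lambda>m. ennreal (exp (- (rate * ?I m)))) \<longlonglongrightarrow>
      ennreal (exp (- (rate * (\<integral>x. indicator {0<..<T} x * (1 - g x) \<partial>lborel))))"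
    by (intro tendsto_intros)
  moreover have "(\<lambda>m. \<integral>\<^sup>+ \<omega>. (\<Prod>i<K \<omega>. ennreal (?W m (S i 0 \<omega>))) \<partial>M)
      \<longlonglongrightarrow> (\<integral>\<^sup>+ \<omega>. (\<Prod>i<K \<omega>. ennreal (g (S i 0 \<omega>))) \<partial>M)"
  proof (rule nn_integral_dominated_convergence[where w="\<lambda>_. 1"])
    show "AE \<omega> in M. (\<Prod>i<K \<omega>. ennreal (?W m (S i 0 \<omega>))) \<le> 1" for m
      using W by (intro AE_I2) (simp add: prod_ennreal prod_le_1)
    show "(\<integral>\<^sup>+ \<omega>. 1 \<partial>M) < \<infinity>" by (simp add: emeasure_space_1)
    show "AE \<omega> in M. (\<lambda>m. \<Prod>i<K \<omega>. ennreal (?W m (S i 0 \<omega>))) \<longlonglongrightarrow> (\<Prod>i<K \<omega>. ennreal (g (S i 0 \<omega>)))"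
      using AE_arrival_pos
    proof eventually_elim
      case (elim \<omega>)
      have "(\<lambda>m. ennreal (\<Prod>i<K \<omega>. ?W m (S i 0 \<omega>))) \<longlonglongrightarrow> ennreal (\<Prod>i<K \<omega>. g (S i 0 \<omega>))"
        using elim by (intro tendsto_ennrealI tendsto_prod conv) auto
      then show ?case using W g by (simp add: prod_ennreal)
    qed
  qed (auto intro!: measurable_prod_number)
  ultimately show ?thesis
    unfolding eq using LIMSEQ_unique by blast
qed

context
  assumes \<alpha>: "0 < \<alpha>" "\<alpha> \<le> 1"
begin

interpretation L: bid_law T \<alpha>
  by standard (fact \<alpha>)+

lemma nn_integral_prod_bids_cell:
  assumes t: "\<forall>j<n. t j \<le> t (Suc j)" "t n \<le> T" and z: "\<And>j. j < n \<Longrightarrow> 0 \<le> z j \<and> z j \<le> 1"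
  shows "(\<integral>\<^sup>+ \<omega>. (\<Prod>i<K \<omega>. ennreal (cell_weight n t z (S i (first_bid i \<omega>) \<omega>))) \<partial>M)
    = (\<integral>\<^sup>+ \<omega>. (\<Prod>i<K \<omega>. ennreal (L.cell_mean n t z (S i 0 \<omega>))) \<partial>M)"
  using L.cell_mean_bounds(2)[OF t z] L.cell_mean_fixed_point[OF t z]
  by (intro nn_integral_prod_bids[OF \<alpha>]) (auto simp: ennreal_le_1)

lemma bid_count_diff:
  assumes "\<forall>i. bid_time (\<lambda>k. S i k \<omega>) (\<lambda>k. D i k \<omega>) = ereal (S i (first_bid i \<omega>) \<omega>)" "a \<le> b"
  shows "bid_count K S D b \<omega> - bid_count K S D a \<omega>
    = card {i\<in>{..<K \<omega>}. a < S i (first_bid i \<omega>) \<omega> \<and> S i (first_bid i \<omega>) \<omega> \<le> b}"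
  using assms by (simp add: bid_count_def card_diff_atMost)

lemma bid_count_pgf:
  assumes t: "0 \<le> t 0" "\<forall>j<n. t j \<le> t (Suc j)" "t n \<le> T" and z: "\<And>j. j < n \<Longrightarrow> 0 \<le> z j \<and> z j \<le> 1"
  shows "(\<integral>\<^sup>+ \<omega>. ennreal (\<Prod>j<n. z j ^ (bid_count K S D (t (Suc j)) \<omega> - bid_count K S D (t j) \<omega>)) \<partial>M)
    = ennreal (\<Prod>j<n. exp (- ((1 - z j) * (rate * (bid_cdf_integral T \<alpha> (t (Suc j)) 0 - bid_cdf_integral T \<alpha> (t j) 0)))))"
proof -
  have "(\<integral>\<^sup>+ \<omega>. ennreal (\<Prod>j<n. z j ^ (bid_count K S D (t (Suc j)) \<omega> - bid_count K S D (t j) \<omega>)) \<partial>M)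
    = (\<integral>\<^sup>+ \<omega>. (\<Prod>i<K \<omega>. ennreal (cell_weight n t z (S i (first_bid i \<omega>) \<omega>))) \<partial>M)"
  proof (rule nn_integral_cong_AE)
    show "AE \<omega> in M. ennreal (\<Prod>j<n. z j ^ (bid_count K S D (t (Suc j)) \<omega> - bid_count K S D (t j) \<omega>))
      = (\<Prod>i<K \<omega>. ennreal (cell_weight n t z (S i (first_bid i \<omega>) \<omega>)))"
      using AE_bid_time[OF \<alpha>]
    proof eventually_elim
      case (elim \<omega>)
      have "(\<Prod>i<K \<omega>. ennreal (cell_weight n t z (S i (first_bid i \<omega>) \<omega>)))
        = ennreal (\<Prod>j<n. z j ^ card {i\<in>{..<K \<omega>}. t j < S i (first_bid i \<omega>) \<omega> \<and> S i (first_bid i \<omega>) \<omega> \<le> t (Suc j)})"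
        using cell_weight_bounds(1)[OF z] by (simp add: prod_ennreal prod_cell_weight)
      then show ?case
        using t by (simp add: bid_count_diff[OF elim])
    qed
  qed
  also have "\<dots> = (\<integral>\<^sup>+ \<omega>. (\<Prod>i<K \<omega>. ennreal (L.cell_mean n t z (S i 0 \<omega>))) \<partial>M)"
    by (rule nn_integral_prod_bids_cell[OF t(2,3) z])
  also have "\<dots> = ennreal (exp (- (rate * (\<integral>x. indicator {0<..<T} x * (1 - L.cell_mean n t z x) \<partial>lborel))))"
    using L.cell_mean_bounds[OF t(2,3) z] L.cell_mean_left_continuous[OF t(2,3)]
    by (intro nn_integral_prod_arrivals) auto
  also have "(\<integral>x. indicator {0<..<T} x * (1 - L.cell_mean n t z x) \<partial>lborel)
      = (\<Sum>j<n. (1 - z j) * (bid_cdf_integral T \<alpha> (t (Suc j)) 0 - bid_cdf_integral T \<alpha> (t j) 0))"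
    by (rule has_bochner_integral_integral_eq[OF L.has_integral_cell_mean[OF t(2,3) T]])
  finally show ?thesis
    by (simp add: exp_sum[symmetric] sum_negf sum_distrib_left mult.left_commute)
qed

lemma AE_bid_pos: "AE \<omega> in M. bid_count K S D 0 \<omega> = 0"
proof -
  note [measurable] = time_measurable number_measurable measurable_first_bid
  have [measurable]: "(\<lambda>\<omega>. S i (first_bid i \<omega>) \<omega>) \<in> borel_measurable M" for i
    by (rule measurable_compose_countable[where f="\<lambda>k. S i k"]) auto
  \<comment> \<open>Cells are bounded, so the half-line up to 0 is exhausted by the intervals from
    \<open>- real m\<close> to 0.\<close>
  have "AE \<omega> in M. \<forall>i<K \<omega>. \<not> (- real m < S i (first_bid i \<omega>) \<omega> \<and> S i (first_bid i \<omega>) \<omega> \<le> 0)" for m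
  proof -
    \<comment> \<open>With weight \<open>0\<close> on \<open>(-m, 0]\<close> the mean is \<open>1\<close> at positive arrival times.\<close>
    define t where "t j = (if j = 0 then - real m else 0)" for j :: nat
    let ?z = "\<lambda>_ :: nat. 0 :: real"
    let ?W = "\<lambda>\<omega>. \<Prod>i<K \<omega>. ennreal (cell_weight 1 t ?z (S i (first_bid i \<omega>) \<omega>))"
    have t: "\<forall>j<1. t j \<le> t (Suc j)" "t 1 \<le> T" using T by (auto simp: t_def)
    have [measurable]: "?W \<in> borel_measurable M"
      by (rule measurable_prod_number) measurable
    have w: "cell_weight 1 t ?z x = (if - real m < x \<and> x \<le> 0 then 0 else 1)" for x
      by (simp add: cell_weight_def t_def)
    have W1: "?W \<omega> \<le> 1" for \<omega>
      by (simp add: w prod_ennreal prod_le_1 del: One_nat_def)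
    have "(\<integral>\<^sup>+ \<omega>. ?W \<omega> \<partial>M) = (\<integral>\<^sup>+ \<omega>. (\<Prod>i<K \<omega>. ennreal (L.cell_mean 1 t ?z (S i 0 \<omega>))) \<partial>M)"
      using t by (intro nn_integral_prod_bids_cell) auto
    also have "\<dots> = (\<integral>\<^sup>+ \<omega>. 1 \<partial>M)"
    proof (rule nn_integral_cong_AE)
      show "AE \<omega> in M. (\<Prod>i<K \<omega>. ennreal (L.cell_mean 1 t ?z (S i 0 \<omega>))) = 1"
        using AE_arrival_pos
      proof eventually_elim
        case (elim \<omega>)
        have "L.cell_mean 1 t ?z x = 1" if "0 < x" for x
          using that by (simp add: L.cell_mean_def bid_cdf_def t_def)
        then show ?case using elim by (intro prod.neutral) auto
      qed
    qed
    finally have int1: "(\<integral>\<^sup>+ \<omega>. ?W \<omega> \<partial>M) = 1" by (simp add: emeasure_space_1)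
    have "(\<integral>\<^sup>+ \<omega>. 1 - ?W \<omega> \<partial>M) = (\<integral>\<^sup>+ \<omega>. 1 \<partial>M) - (\<integral>\<^sup>+ \<omega>. ?W \<omega> \<partial>M)"
      using W1 int1 by (intro nn_integral_diff) auto
    then have "(\<integral>\<^sup>+ \<omega>. 1 - ?W \<omega> \<partial>M) = 0"
      unfolding int1 by (simp add: emeasure_space_1)
    then have "AE \<omega> in M. 1 - ?W \<omega> = 0"
      by (rule nn_integral_0_iff_AE[THEN iffD1, rotated]) measurable
    then show ?thesis
    proof eventually_elim
      case (elim \<omega>)
      then have "?W \<omega> = 1"
        using W1[of \<omega>] by (metis diff_eq_0_iff_ennreal antisym ennreal_one_less_top)
      show ?case
      proof (intro allI impI notI)
        fix i assume "i < K \<omega>" "- real m < S i (first_bid i \<omega>) \<omega> \<and> S i (first_bid i \<omega>) \<omega> \<le> 0"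
        then have "?W \<omega> = 0" by (intro prod_zero) (auto simp: w simp del: One_nat_def intro!: bexI[of _ i])
        with \<open>?W \<omega> = 1\<close> show False by simp
      qed
    qed
  qed
  then have "AE \<omega> in M. \<forall>m. \<forall>i<K \<omega>. \<not> (- real m < S i (first_bid i \<omega>) \<omega> \<and> S i (first_bid i \<omega>) \<omega> \<le> 0)"
    by (simp add: AE_all_countable)
  then show ?thesis
    using AE_bid_time[OF \<alpha>]
  proof eventually_elim
    case (elim \<omega>)
    have "0 < S i (first_bid i \<omega>) \<omega>" if "i < K \<omega>" for i
      using elim(1) that reals_Archimedean2[of "- S i (first_bid i \<omega>) \<omega>"] by (metis minus_less_iff not_le)
    then show ?case
      using elim(2) by (auto simp: bid_count_def finite_less_Collect not_le zero_ereal_def[symmetric])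
  qed
qed

lemma mono_bid_count: "mono_on A (\<lambda>t. bid_count K S D t \<omega>)"
  unfolding bid_count_def
  by (intro mono_onI card_mono finite_less_Collect) (auto elim: order_trans)

text \<open>Each condition \<open>bid_time \<le> u\<close> keeps its truth value for
  \<open>u\<close> slightly above \<open>t\<close>; as only finitely many bidders count, the whole
  count is constant just to the right of \<open>t\<close>.\<close>

lemma bid_count_right_continuous: "continuous (at_right t) (\<lambda>t. bid_count K S D t \<omega>)"
proof -
  let ?b = "\<lambda>i. bid_time (\<lambda>k. S i k \<omega>) (\<lambda>k. D i k \<omega>)"
  have "\<forall>\<^sub>F u in at_right t. ?b i \<le> ereal u \<longleftrightarrow> ?b i \<le> ereal t" for i
  proof (cases "?b i \<le> ereal t")
    case True
    have "\<forall>\<^sub>F u in at_right t. t < u" by (simp add: eventually_at_right_less)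
    then show ?thesis
      by eventually_elim (use True in \<open>auto elim: order_trans\<close>)
  next
    case False
    \<comment> \<open>A finite bid time serves as \<open>r\<close> itself; if no bid is ever placed,
      \<open>t + 1\<close> will do.\<close>
    then obtain r where r: "t < r" "ereal r \<le> ?b i"
      by (cases "?b i") (auto simp: not_le intro: that[of "t + 1"])
    have "\<forall>\<^sub>F u in at_right t. u < r"
      using r(1) by (intro eventually_at_rightI[of t r]) auto
    then show ?thesis
      by eventually_elim (use False order_trans[OF r(2)] in force)
  qed
  then have "\<forall>\<^sub>F u in at_right t. \<forall>i\<in>{..<K \<omega>}. ?b i \<le> ereal u \<longleftrightarrow> ?b i \<le> ereal t"
    by (intro eventually_ball_finite) auto
  then have "\<forall>\<^sub>F u in at_right t. bid_count K S D t \<omega> = bid_count K S D u \<omega>"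
  proof eventually_elim
    case (elim u)
    then show ?case
      unfolding bid_count_def by (intro arg_cong[where f=card]) auto
  qed
  then show ?thesis
    unfolding continuous_within by (rule Lim_transform_eventually[rotated]) simp
qed

text \<open>The generating functions give the mean
  \<open>rate * T * (1 - (1 - t / T) powr \<alpha>)\<close> for the bids in \<open>(0, t]\<close>;
  its derivative explains the constant \<open>rate * \<alpha>\<close>.\<close>

lemma poisson_process_bid_count:
  assumes rate: "0 < rate"
  shows "poisson_process_on M T (\<lambda>t. rate * \<alpha> * (1 - t / T) powr (\<alpha> - 1)) (bid_count K S D)"
proof -
  let ?r = "\<lambda>t. rate * \<alpha> * (1 - t / T) powr (\<alpha> - 1)"
  let ?N = "bid_count K S D"
  let ?J = "\<lambda>t. bid_cdf_integral T \<alpha> t 0"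
  have mean: "(LINT x:{u<..<v}|lborel. ?r x) = rate * (?J v - ?J u)" if "0 \<le> u" "u \<le> v" "v \<le> T" for u v
  proof -
    have J: "?J t = T * (1 - (1 - t / T) powr \<alpha>)" if "0 \<le> t" for t
      using that T by (simp add: bid_cdf_integral_def diff_divide_distrib)
    have "rate * \<alpha> * T / \<alpha> * (A - B) = rate * (T * (1 - B) - T * (1 - A))" for A B
      using \<alpha> by (simp add: field_simps)
    moreover have "0 \<le> v" "0 \<le> rate * \<alpha>" using that rate \<alpha> by auto
    ultimately show ?thesis
      using that T \<alpha> by (simp only: LINT_bid_intensity(2) J)
  qed
  have mean_nonneg: "0 \<le> rate * (?J v - ?J u)" if "0 \<le> u" "u \<le> v" "v \<le> T" for u v
    unfolding mean[OF that, symmetric] set_lebesgue_integral_def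
    using rate \<alpha> by (intro Bochner_Integration.integral_nonneg) auto
  have incr: "indep_vars (\<lambda>_. count_space UNIV) (\<lambda>j \<omega>. ?N (t (Suc j)) \<omega> - ?N (t j) \<omega>) {..<n}"
    "\<And>k L. L \<subseteq> {..<n} \<Longrightarrow> prob {\<omega>\<in>space M. \<forall>j\<in>L. ?N (t (Suc j)) \<omega> - ?N (t j) \<omega> = k j}
      = (\<Prod>j\<in>L. (rate * (?J (t (Suc j)) - ?J (t j))) ^ k j / fact (k j) * exp (- (rate * (?J (t (Suc j)) - ?J (t j)))))"
    if t: "0 \<le> t 0" "\<forall>j<n. t j \<le> t (Suc j)" "t n \<le> T" for n and t :: "nat \<Rightarrow> real"
  proof -
    have meas: "(\<lambda>\<omega>. ?N (t (Suc j)) \<omega> - ?N (t j) \<omega>) \<in> measurable M (count_space UNIV)" for j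
      using measurable_bid_count[of "t j"] measurable_bid_count[of "t (Suc j)"] by measurable
    have nonneg: "0 \<le> rate * (?J (t (Suc j)) - ?J (t j))" if "j < n" for j
      using t that mono_upto[OF t(2), of 0 j] mono_upto[OF t(2), of "Suc j" n] by (intro mean_nonneg) auto
    show "indep_vars (\<lambda>_. count_space UNIV) (\<lambda>j \<omega>. ?N (t (Suc j)) \<omega> - ?N (t j) \<omega>) {..<n}"
      by (rule indep_vars_from_pgf[OF meas nonneg bid_count_pgf[OF t]])
    show "prob {\<omega>\<in>space M. \<forall>j\<in>L. ?N (t (Suc j)) \<omega> - ?N (t j) \<omega> = k j}
      = (\<Prod>j\<in>L. (rate * (?J (t (Suc j)) - ?J (t j))) ^ k j / fact (k j) * exp (- (rate * (?J (t (Suc j)) - ?J (t j)))))"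
      if "L \<subseteq> {..<n}" for L k
      by (rule prob_from_pgf[OF meas nonneg bid_count_pgf[OF t] that])
  qed
  have poisson: "prob {\<omega>\<in>space M. ?N v \<omega> - ?N u \<omega> = k}
      = (LINT x:{u<..<v}|lborel. ?r x) ^ k / fact k * exp (- (LINT x:{u<..<v}|lborel. ?r x))"
    if uv: "0 \<le> u" "u \<le> v" "v \<le> T" for u v k
    \<comment> \<open>A single interval is the partition with one cell, with endpoints
      \<open>u\<close> at index 0 and \<open>v\<close> at index 1.\<close>
    unfolding mean[OF uv] using incr(2)[of "\<lambda>j. if j = 0 then u else v" 1 "{0}" "\<lambda>_. k"] uv by simp
  show ?thesis
    unfolding poisson_process_on_def
    using prob_space_axioms measurable_bid_count AE_bid_pos mono_bid_count bid_count_right_continuous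
      set_integrable_bid_intensity[of T \<alpha> "rate * \<alpha>"] incr(1) poisson T \<alpha> rate
    by auto
qed

end

end

end

text \<open>A uniform arrival is, up to null endpoints, one kernel step started at 0. The
  probability is therefore the kernel mean of \<open>bid_cdf\<close> at 0, that is
  \<open>bid_cdf_integral T \<alpha> t 0 / T\<close>; the factor \<open>1 - \<alpha>\<close> of
  \<open>bid_cdf\<close> disappears because no decision is taken at 0.\<close>

lemma (in bidder) prob_bid_time_le:
  assumes T: "0 < T" and \<alpha>: "0 < \<alpha>" "\<alpha> \<le> 1"
    and arrival: "distr M borel (s 0) = uniform_measure lborel {0..T}" and t: "0 \<le> t" "t \<le> T"
  shows "prob {\<omega>\<in>space M. bid_time (\<lambda>k. s k \<omega>) (\<lambda>k. d k \<omega>) \<le> ereal t} = 1 - (1 - t / T) powr \<alpha>"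
proof -
  interpret L: bid_law T \<alpha> by standard (fact \<alpha>)+
  note [measurable] = time_measurable measurable_trial[OF decisions_indep decision_prob \<alpha>]
  have [measurable]: "(\<lambda>\<omega>. s (LEAST k. d k \<omega>) \<omega>) \<in> borel_measurable M"
    by (rule measurable_compose_countable[where f="\<lambda>k. s k"]) auto
  have "AE x in uniform_measure lborel {0..T}. x < T"
    using AE_lborel_singleton[of T] by (intro AE_uniform_measureI) (auto elim!: eventually_mono)
  then have arr: "AE \<omega> in M. s 0 \<omega> < T"
    unfolding arrival[symmetric] by (subst (asm) AE_distr_iff) auto
  let ?E = "{\<omega>\<in>space M. bid_time (\<lambda>k. s k \<omega>) (\<lambda>k. d k \<omega>) \<le> ereal t}"
  have E: "?E \<in> sets M"
    unfolding bid_time_le_iff by measurable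
  have "emeasure M ?E = (\<integral>\<^sup>+ \<omega>. indicator ?E \<omega> \<partial>M)"
    using E by simp
  also have "\<dots> = (\<integral>\<^sup>+ \<omega>. indicator {..t} (s (LEAST k. d k \<omega>) \<omega>) \<partial>M)"
  proof (rule nn_integral_cong_AE)
    show "AE \<omega> in M. indicator ?E \<omega> = (indicator {..t} (s (LEAST k. d k \<omega>) \<omega>) :: ennreal)"
      using AE_ex_success[OF decisions_indep decision_prob \<alpha>] AE_space
      by eventually_elim (simp add: bid_time_eq indicator_def)
  qed
  also have "\<dots> = (\<integral>\<^sup>+ \<omega>. ennreal (bid_cdf T \<alpha> t (s 0 \<omega>)) \<partial>M)"
    using L.bid_cdf_le_1 L.bid_cdf_fixed_point_ennreal[OF t(2)]
    by (intro nn_integral_bid[OF \<alpha> _ _ _ _ arr]) (auto simp: ennreal_le_1)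
  also have "\<dots> = (\<integral>\<^sup>+ x. ennreal (bid_cdf T \<alpha> t x) \<partial>uniform_measure lborel {0..T})"
    unfolding arrival[symmetric] by (subst nn_integral_distr) auto
  also have "\<dots> = unif_mean T (\<lambda>x. ennreal (bid_cdf T \<alpha> t x)) 0"
  proof -
    have "(\<integral>\<^sup>+ x. ennreal (bid_cdf T \<alpha> t x) * indicator {0..T} x \<partial>lborel)
        = (\<integral>\<^sup>+ x. ennreal (bid_cdf T \<alpha> t x) * indicator {0<..<T} x \<partial>lborel)"
      using AE_lborel_singleton[of 0] AE_lborel_singleton[of T]
      by (intro nn_integral_cong_AE, eventually_elim) (auto simp: indicator_def)
    then show ?thesis
      using T by (simp add: unif_mean_eq nn_integral_uniform_measure)
  qed
  also have "\<dots> = ennreal (bid_cdf_integral T \<alpha> t 0 / T)"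
    using unif_mean_ennreal(1)[OF measurable_bid_cdf L.bid_cdf_nonneg[OF t(2)] T L.has_integral_bid_cdf[OF t(2) T]]
    by simp
  also have "bid_cdf_integral T \<alpha> t 0 / T = 1 - (1 - t / T) powr \<alpha>"
    using t T by (simp add: bid_cdf_integral_def diff_divide_distrib)
  finally show ?thesis
    using t T \<alpha> by (simp add: emeasure_eq_measure powr_le1)
qed

theorem mainTheorem2:
  fixes T rate \<alpha> :: real
    and M :: "'a measure" and K :: "'a \<Rightarrow> nat"
    and S :: "nat \<Rightarrow> nat \<Rightarrow> 'a \<Rightarrow> real" and D :: "nat \<Rightarrow> nat \<Rightarrow> 'a \<Rightarrow> bool"
    and M' :: "'b measure"
    and s :: "nat \<Rightarrow> 'b \<Rightarrow> real" and d :: "nat \<Rightarrow> 'b \<Rightarrow> bool"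
  assumes "T > 0" and "rate > 0" and "0 < \<alpha>" and "\<alpha> \<le> 1"
    and auction: "bidder_population M T \<alpha> K S D"
    and arrivals: "poisson_process_on M T (\<lambda>_. rate) (arrival_count K S)"
    and random_bidder: "bidder M' T \<alpha> s d"
    and random_arrival: "distr M' borel (s 0) = uniform_measure lborel {0..T}"
  shows "(\<forall>t\<in>{0..T}.
            measure M' {\<omega>\<in>space M'. bid_time (\<lambda>k. s k \<omega>) (\<lambda>k. d k \<omega>) \<le> ereal t}
              = 1 - (1 - t / T) powr \<alpha>) \<and>
         (\<exists>c>0. poisson_process_on M T (\<lambda>t. c * (1 - t / T) powr (\<alpha> - 1)) (bid_count K S D))"
proof (intro conjI ballI exI[of _ "rate * \<alpha>"])
  show "poisson_process_on M T (\<lambda>t. rate * \<alpha> * (1 - t / T) powr (\<alpha> - 1)) (bid_count K S D)"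
    using bidder_population.poisson_process_bid_count[OF auction] assms by blast
qed (use assms bidder.prob_bid_time_le[OF random_bidder] in auto)

end
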